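(* For each $n\ge 1$ let $A_0,A_1,\ldots,A_n$ be independent and identically distributed $\mathrm{N}(0,1)$ random variables, and let $r_n$ be the probability that all the $n$ complex roots of the random polynomial $Q(\lambda)=A_n\lambda^n+A_{n-1}\lambda^{n-1}+\cdots+A_1\lambda+A_0$ have negative real part (equivalently, the probability that the zero solution of the random linear differential equation $A_nx^{(n)}+A_{n-1}x^{(n-1)}+\cdots+A_1x'+A_0x=0$ is a global asymptotically stable attractor). Then $r_n\le \frac{1}{2^n}$ for all $n\ge 1$. Moreover, $r_1=\frac12$, $r_2=\frac14$, $r_3=\frac1{16}$ and $r_4<\frac{r_3}{2}=\frac1{32}$.
   Context: Since $A_n\neq 0$ almost surely, $Q$ has degree $n$ almost surely. *)

theory Defs
  imports "HOL-Probability.Probability" "HOL-Computational_Algebra.Polynomial"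
begin

definition poly_of_coeffs :: "nat \<Rightarrow> (nat \<Rightarrow> real) \<Rightarrow> real poly" where
  "poly_of_coeffs n a = (\<Sum>k\<le>n. monom (a k) k)"

definition all_roots_neg_Re :: "real poly \<Rightarrow> bool" where
  "all_roots_neg_Re p \<longleftrightarrow>
     (\<forall>z::complex. poly (map_poly complex_of_real p) z = 0 \<longrightarrow> Re z < 0)"

text \<open>The homogeneous linear equation with constant coefficients \<open>p(d/dt) x = 0\<close>, of order
  \<open>degree p\<close>. Its solutions extend to the whole real line, so they are taken there.\<close>

definition linear_ode_solution :: "real poly \<Rightarrow> (real \<Rightarrow> real) \<Rightarrow> bool" where
  "linear_ode_solution p x \<longleftrightarrow>
     (\<forall>k<degree p. \<forall>t. (deriv ^^ k) x differentiable (at t)) \<and>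
     (\<forall>t. (\<Sum>k\<le>degree p. coeff p k * (deriv ^^ k) x t) = 0)"

text \<open>Stability and attraction refer to the phase space of the equation, that is, to the vector
  \<open>(x, x', \<dots>, x\<^sup>(\<^sup>m\<^sup>-\<^sup>1\<^sup>))\<close> with \<open>m = degree p\<close>. As the equation is autonomous, it is enough to
  consider the initial time 0.\<close>

definition zero_lyapunov_stable :: "real poly \<Rightarrow> bool" where
  "zero_lyapunov_stable p \<longleftrightarrow>
     (\<forall>\<epsilon>>0. \<exists>\<delta>>0. \<forall>x. linear_ode_solution p x \<longrightarrow>
        (\<forall>k<degree p. \<bar>(deriv ^^ k) x 0\<bar> < \<delta>) \<longrightarrow>
        (\<forall>t\<ge>0. \<forall>k<degree p. \<bar>(deriv ^^ k) x t\<bar> < \<epsilon>))"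

definition zero_globally_attracting :: "real poly \<Rightarrow> bool" where
  "zero_globally_attracting p \<longleftrightarrow>
     (\<forall>x. linear_ode_solution p x \<longrightarrow>
        (\<forall>k<degree p. ((deriv ^^ k) x \<longlongrightarrow> 0) at_top))"

definition zero_globally_asymptotically_stable :: "real poly \<Rightarrow> bool" where
  "zero_globally_asymptotically_stable p \<longleftrightarrow>
     zero_lyapunov_stable p \<and> zero_globally_attracting p"

end

theory Submission
  imports Defs "HOL-Computational_Algebra.Fundamental_Theorem_Algebra"
begin

text \<open>A real polynomial with all roots in the open left half-plane is a product of linear and
  quadratic factors with positive coefficients, so its coefficients have a common sign, an event
  of probability \<open>2 / 2^(n+1)\<close>. Up to degree two this condition is also sufficient; in degree three one
  adds \<open>a 0 * a 3 < a 1 * a 2\<close>, which holds with conditional probability \<open>1/2\<close> by exchangeability,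
  and which is necessary but not sufficient in degree four.\<close>

subsection \<open>Asymptotic stability and the roots of the characteristic polynomial\<close>

text \<open>The link with global asymptotic stability is deterministic: decay bounds uniform in the
  solution give one direction, the solution Re (exp (z t)) for a bad root z the other. The zero
  polynomial is the only exception: its equation has order 0 and is vacuously stable, but it occurs
  with probability 0. A measure-theoretic obstacle shapes the rest: \<open>measure\<close> returns 0
  on non-measurable sets. Upper bounds therefore pass through measurable supersets, while the exact
  values in degrees one to three also need measurability of the root event. That is obtained by
  recursion on the degree, because a vanishing leading coefficient leaves a polynomial of lower
  degree and the space is not assumed complete. The necessary inequalities in degrees three and four
  come from splitting off a quadratic factor, after which the relevant differences become sums of
  positive monomials.\<close>

text \<open>Variation of constants: the integrating factor exp (- z s) leaves h' = exp (- z s) g, of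
  norm at most B exp (m s) with m = - Re z - \<delta> > 0. Comparison with the antiderivative
  \<open>\<phi>\<close> of that bound controls \<open>h\<close>; multiplying back by exp (z t) uses
  Re z + m = - \<delta>.\<close>

lemma norm_decay_of_vector_derivative:
  fixes f g :: "real \<Rightarrow> complex"
  assumes f: "\<And>t. (f has_vector_derivative (z * f t + g t)) (at t)"
    and g: "\<And>t. t \<ge> 0 \<Longrightarrow> norm (g t) \<le> B * exp (- \<delta> * t)"
    and z: "Re z < - \<delta>" and t: "t \<ge> 0"
  shows "norm (f t) \<le> (norm (f 0) + B / (- Re z - \<delta>)) * exp (- \<delta> * t)"
proof -
  define m where "m = - Re z - \<delta>"
  have m: "m > 0" using z by (simp add: m_def)
  have B: "B \<ge> 0" using order_trans[OF norm_ge_zero g[of 0]] by simp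
  define h where "h s = exp (- z * of_real s) * f s" for s :: real
  define \<phi> where "\<phi> s = B / m * exp (m * s)" for s :: real
  have E: "((\<lambda>s. exp (- z * of_real s)) has_vector_derivative (- z * exp (- z * of_real s))) (at s)" for s
  proof -
    have "((\<lambda>w. exp (- z * w)) has_field_derivative (- z * exp (- z * of_real s))) (at (of_real s))"
      by (auto intro!: derivative_eq_intros)
    from has_vector_derivative_real_field[OF this] show ?thesis by simp
  qed
  have h': "(h has_vector_derivative exp (- z * of_real s) * g s) (at s)" for s
  proof -
    have "(h has_vector_derivative exp (- z * of_real s) * (z * f s + g s) + (- z * exp (- z * of_real s)) * f s) (at s)"
      unfolding h_def by (rule has_vector_derivative_mult[OF E f])
    thus ?thesis by (simp add: algebra_simps)
  qed
  have phi': "(\<phi> has_vector_derivative B * exp (m * s)) (at s)" for s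
    unfolding has_real_derivative_iff_has_vector_derivative[symmetric] \<phi>_def
    using m by (auto intro!: derivative_eq_intros simp: field_simps)
  have "norm (h t - h 0) \<le> \<phi> t - \<phi> 0"
  proof (cases "t = 0")
    case False
    hence "0 < t" using t by simp
    thus ?thesis
    proof (rule differentiable_bound_general[where f' = "\<lambda>s. exp (- z * of_real s) * g s" and \<phi>' = "\<lambda>s. B * exp (m * s)"])
      show "continuous_on {0..t} h"
        using h' by (auto intro!: continuous_at_imp_continuous_on has_vector_derivative_continuous)
      show "continuous_on {0..t} \<phi>"
        using phi' by (auto intro!: continuous_at_imp_continuous_on has_vector_derivative_continuous)
      fix s :: real assume s: "0 < s"
      have "norm (exp (- z * of_real s) * g s) \<le> exp (- Re z * s) * (B * exp (- \<delta> * s))"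
        using g[of s] s by (simp add: norm_mult)
      also have "\<dots> = B * (exp (- Re z * s) * exp (- \<delta> * s))" by (simp only: mult_ac)
      also have "exp (- Re z * s) * exp (- \<delta> * s) = exp (m * s)"
        unfolding exp_add[symmetric] by (simp add: m_def algebra_simps)
      finally show "norm (exp (- z * of_real s) * g s) \<le> B * exp (m * s)" .
    qed (use h' phi' in auto)
  qed simp
  also have "\<dots> \<le> B / m * exp (m * t)" using B m by (simp add: \<phi>_def)
  finally have "norm (h t) \<le> norm (f 0) + B / m * exp (m * t)"
    using norm_triangle_ineq2[of "h t" "h 0"] by (simp add: h_def)
  moreover have ft: "f t = exp (z * of_real t) * h t"
    by (simp add: h_def mult.assoc[symmetric] exp_add[symmetric])
  ultimately have "norm (f t) \<le> exp (Re z * t) * (norm (f 0) + B / m * exp (m * t))"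
    by (simp add: norm_mult)
  also have "\<dots> = exp (Re z * t) * norm (f 0) + B / m * (exp (Re z * t) * exp (m * t))"
    by (simp add: distrib_left mult_ac)
  also have "exp (Re z * t) * exp (m * t) = exp (- \<delta> * t)"
    unfolding exp_add[symmetric] by (simp add: m_def algebra_simps)
  also have "exp (Re z * t) * norm (f 0) + B / m * exp (- \<delta> * t) \<le> exp (- \<delta> * t) * norm (f 0) + B / m * exp (- \<delta> * t)"
  proof -
    have "Re z * t \<le> - \<delta> * t" using z t by (intro mult_right_mono) auto
    thus ?thesis by (intro add_right_mono mult_right_mono) auto
  qed
  finally show ?thesis by (simp add: m_def algebra_simps)
qed

text \<open>Dividing off one linear factor \<open>X - z\<close> replaces the derivatives \<open>f k\<close> by
  \<open>f (Suc k) - z * f k\<close>, so that the estimate follows from the scalar one by induction on the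
  degree.\<close>

lemma derivatives_exponential_decay:
  fixes p :: "complex poly" and \<delta> :: real
  assumes "p \<noteq> 0" and "\<And>z. poly p z = 0 \<Longrightarrow> Re z < - \<delta>"
  shows "\<exists>C\<ge>0. \<forall>f K. (\<forall>k<degree p. \<forall>t::real. (f k has_vector_derivative f (Suc k) t) (at t)) \<longrightarrow>
     (\<forall>t\<ge>0. norm (\<Sum>k\<le>degree p. coeff p k * f k t) \<le> K * exp (- \<delta> * t)) \<longrightarrow>
     (\<forall>k<degree p. norm (f k 0) \<le> K) \<longrightarrow>
     (\<forall>k\<le>degree p. \<forall>t\<ge>0. norm (f k t :: complex) \<le> C * K * exp (- \<delta> * t))"
  using assms
proof (induction "degree p" arbitrary: p)
  case 0
  then obtain c where c: "p = [:c:]" "c \<noteq> 0" by (metis degree_eq_zeroE pCons_eq_0_iff)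
  \<comment> \<open>In degree 0 the equation itself bounds the one remaining function, with no
    initial value involved. This is why the conclusion covers one index more than the initial
    data.\<close>
  show ?case
    by (rule exI[of _ "1 / norm c"]) (use c in \<open>auto simp: field_simps norm_mult\<close>)
next
  case (Suc n)
  from Suc.hyps(2) have "\<not> constant (poly p)" by (simp add: constant_degree)
  then obtain z where z: "poly p z = 0" using fundamental_theorem_of_algebra by blast
  then obtain q where q: "p = [:- z, 1:] * q" by (metis dvdE poly_eq_0_iff_dvd)
  have q0: "q \<noteq> 0" using q Suc.prems(1) by auto
  have dq: "n = degree q"
    using Suc.hyps(2) q0 unfolding q by (subst (asm) degree_mult_eq) auto
  have dp: "degree p = Suc n" using Suc.hyps(2) by simp
  have zd: "Re z < - \<delta>" using Suc.prems(2) z by blast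
  obtain C where C: "C \<ge> 0" and IH: "\<And>f K k t. (\<And>k t. k < n \<Longrightarrow> (f k has_vector_derivative f (Suc k) t) (at t)) \<Longrightarrow>
     (\<And>t. t \<ge> 0 \<Longrightarrow> norm (\<Sum>k\<le>n. coeff q k * f k t) \<le> K * exp (- \<delta> * t)) \<Longrightarrow>
     (\<And>k. k < n \<Longrightarrow> norm (f k 0) \<le> K) \<Longrightarrow> k \<le> n \<Longrightarrow> t \<ge> 0 \<Longrightarrow>
     norm (f k t :: complex) \<le> C * K * exp (- \<delta> * t)"
    using Suc.hyps(1)[OF dq q0] Suc.prems(2) q dq by (auto 0 4)
  define m where "m = - Re z - \<delta>"
  have m: "m > 0" using zd by (simp add: m_def)
  \<comment> \<open>The factor 1 + norm z serves twice: initial values of \<open>g\<close> are at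
    most K + norm z * K, and recovering \<open>f (Suc k)\<close> from \<open>g k + z * f k\<close>
    multiplies the bound by at most this factor.\<close>
  define L where "L = 1 + norm z"
  have L: "L \<ge> 1" by (simp add: L_def)
  \<comment> \<open>\<open>B\<close> dominates both the constant C L of the bound for
    \<open>g\<close> and the constant 1 + C L / m that the scalar estimate yields for
    \<open>f 0\<close>.\<close>
  define B where "B = C * L + 1 + C * L / m"
  have CB: "C * L \<le> B" "1 + C * L / m \<le> B" "0 \<le> B" using C L m by (auto simp: B_def)
  show ?case
  proof (intro exI[of _ "B * L ^ Suc n"] conjI allI impI)
    show "0 \<le> B * L ^ Suc n" using CB L by simp
    fix f :: "nat \<Rightarrow> real \<Rightarrow> complex" and K k and t :: real
    assume f': "\<forall>k<degree p. \<forall>t. (f k has_vector_derivative f (Suc k) t) (at t)"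
      and eq: "\<forall>t\<ge>0. norm (\<Sum>k\<le>degree p. coeff p k * f k t) \<le> K * exp (- \<delta> * t)"
      and ini: "\<forall>k<degree p. norm (f k 0) \<le> K"
      and k: "k \<le> degree p" and t: "0 \<le> t"
    have K: "K \<ge> 0" using ini dp norm_ge_zero order_trans zero_less_Suc by metis
    define g where "g k t = f (Suc k) t - z * f k t" for k and t :: real
    have g_bound: "norm (g k t) \<le> C * (L * K) * exp (- \<delta> * t)" if "k \<le> n" "t \<ge> 0" for k t
    proof (rule IH[OF _ _ _ that])
      fix k and t :: real assume "k < n"
      thus "(g k has_vector_derivative g (Suc k) t) (at t)"
        unfolding g_def using f' dp
        by (intro has_vector_derivative_diff has_vector_derivative_mult_right) auto
    next
      fix t :: real assume t: "t \<ge> 0"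
      \<comment> \<open>Multiplication by X - z acts on coefficients as a shift minus z times the
        identity, so the residual of \<open>q\<close> on \<open>g\<close> equals the residual of
        \<open>p\<close> on \<open>f\<close>; the added top term vanishes since \<open>q\<close> has
        degree n.\<close>
      have "(\<Sum>k\<le>n. coeff q k * g k t) = (\<Sum>k\<le>n. coeff q k * f (Suc k) t) - (\<Sum>k\<le>n. z * coeff q k * f k t)"
        by (simp add: g_def algebra_simps sum_subtractf)
      also have "(\<Sum>k\<le>n. z * coeff q k * f k t) = (\<Sum>k\<le>Suc n. z * coeff q k * f k t)"
        using dq by (simp add: coeff_eq_0)
      also have "(\<Sum>k\<le>n. coeff q k * f (Suc k) t) = (\<Sum>k\<le>Suc n. (case k of 0 \<Rightarrow> 0 | Suc j \<Rightarrow> coeff q j) * f k t)"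
        unfolding sum.atMost_Suc_shift by simp
      also have "\<dots> - (\<Sum>k\<le>Suc n. z * coeff q k * f k t) = (\<Sum>k\<le>degree p. coeff p k * f k t)"
        unfolding dp sum_subtractf[symmetric]
        by (intro sum.cong) (auto simp: q algebra_simps coeff_pCons split: nat.splits)
      finally have "norm (\<Sum>k\<le>n. coeff q k * g k t) \<le> K * exp (- \<delta> * t)" using eq t by simp
      also have "\<dots> \<le> L * K * exp (- \<delta> * t)" using mult_right_mono[OF L K] by (intro mult_right_mono) auto
      finally show "norm (\<Sum>k\<le>n. coeff q k * g k t) \<le> L * K * exp (- \<delta> * t)" .
    next
      fix k assume "k < n"
      hence "norm (f (Suc k) 0) \<le> K" "norm (f k 0) \<le> K" using ini dp by auto
      hence "norm (g k 0) \<le> K + norm z * K" unfolding g_def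
        by (intro order_trans[OF norm_triangle_ineq4] add_mono) (auto simp: norm_mult mult_left_mono)
      thus "norm (g k 0) \<le> L * K" by (simp add: L_def algebra_simps)
    qed
    have f0: "norm (f 0 t) \<le> B * K * exp (- \<delta> * t)"
    proof -
      have "norm (f 0 t) \<le> (norm (f 0 0) + C * (L * K) / (- Re z - \<delta>)) * exp (- \<delta> * t)"
        using f' dp g_bound[of 0] zd t
        by (intro norm_decay_of_vector_derivative[where g = "g 0"]) (auto simp: g_def)
      also have "\<dots> \<le> B * K * exp (- \<delta> * t)"
      proof (intro mult_right_mono)
        have "norm (f 0 0) + C * (L * K) / m \<le> (1 + C * L / m) * K" using ini dp by (simp add: algebra_simps)
        also have "\<dots> \<le> B * K" using CB(2) K by (intro mult_right_mono)
        finally show "norm (f 0 0) + C * (L * K) / (- Re z - \<delta>) \<le> B * K" by (simp add: m_def)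
      qed simp
      finally show ?thesis .
    qed
    have "norm (f k t) \<le> B * K * exp (- \<delta> * t) * L ^ k" using k
    proof (induction k)
      case 0 thus ?case using f0 by simp
    next
      case (Suc k)
      define W where "W = B * K * exp (- \<delta> * t)"
      have W: "W \<ge> 0" using CB K by (simp add: W_def)
      have "f (Suc k) t = g k t + z * f k t" by (simp add: g_def)
      hence "norm (f (Suc k) t) \<le> norm (g k t) + norm z * norm (f k t)"
        by (metis norm_mult norm_triangle_ineq)
      also have "norm (g k t) \<le> W"
      proof -
        have "norm (g k t) \<le> (C * L) * K * exp (- \<delta> * t)" using g_bound[of k t] Suc.prems dp t by (simp add: mult_ac)
        also have "\<dots> \<le> W" unfolding W_def using CB K by (intro mult_right_mono) auto
        finally show ?thesis .
      qed
      also have "W \<le> W * L ^ k" using L W by (simp add: mult_left_mono[of 1 "L ^ k" W, simplified])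
      also have "norm z * norm (f k t) \<le> norm z * (W * L ^ k)"
        using Suc by (intro mult_left_mono) (auto simp: W_def)
      finally show ?case unfolding W_def[symmetric] by (simp add: L_def algebra_simps)
    qed
    also have "\<dots> \<le> B * K * exp (- \<delta> * t) * L ^ Suc n"
      using k dp L CB K by (intro mult_left_mono power_increasing) auto
    finally show "norm (f k t) \<le> B * L ^ Suc n * K * exp (- \<delta> * t)" by (simp add: mult_ac)
  qed
qed

lemma finite_Re_neg_bound:
  assumes "finite S" "\<And>z. z \<in> S \<Longrightarrow> Re z < 0"
  obtains \<delta> where "\<delta> > 0" "\<And>z. z \<in> S \<Longrightarrow> Re z < - \<delta>"
proof (cases "S = {}")
  case False
  define m where "m = Max (Re ` S)"
  have "m < 0" using assms False by (auto simp: m_def)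
  moreover have "Re z \<le> m" if "z \<in> S" for z using that assms by (auto simp: m_def)
  ultimately show ?thesis using that[of "- m / 2"] by force
qed (use that[of 1] in auto)

lemma degree_map_poly_complex_of_real [simp]: "degree (map_poly complex_of_real p) = degree p"
  by (rule degree_map_poly) auto

lemma coeff_map_poly_complex_of_real [simp]:
  "coeff (map_poly complex_of_real p) k = complex_of_real (coeff p k)"
  by (simp add: coeff_map_poly)

lemma map_poly_complex_of_real_eq_0_iff [simp]: "map_poly complex_of_real p = 0 \<longleftrightarrow> p = 0"
  by (simp add: poly_eq_iff)

text \<open>There are finitely many roots, so their negative real parts stay away from 0 by some
  \<open>\<delta>\<close>. The constants do not depend on the solution: linearity of the bound in
  \<open>K\<close> yields Lyapunov stability, and its exponential factor yields attraction.\<close>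

lemma linear_ode_solution_decay:
  assumes p: "p \<noteq> 0" and neg: "all_roots_neg_Re p"
  obtains C \<delta> where "C \<ge> 0" "\<delta> > 0"
    "\<And>x K k t. linear_ode_solution p x \<Longrightarrow> (\<And>j. j < degree p \<Longrightarrow> \<bar>(deriv ^^ j) x 0\<bar> \<le> K) \<Longrightarrow> 0 \<le> K \<Longrightarrow>
       k < degree p \<Longrightarrow> t \<ge> 0 \<Longrightarrow> \<bar>(deriv ^^ k) x t\<bar> \<le> C * K * exp (- \<delta> * t)"
proof -
  define P where "P = map_poly complex_of_real p"
  have P: "P \<noteq> 0" using p by (simp add: P_def)
  obtain \<delta> where \<delta>: "\<delta> > 0" "\<And>z. poly P z = 0 \<Longrightarrow> Re z < - \<delta>"
    using finite_Re_neg_bound[of "{z. poly P z = 0}"] poly_roots_finite[OF P] neg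
    unfolding all_roots_neg_Re_def P_def by auto
  obtain C where C: "C \<ge> 0" and bnd: "\<And>f K k t.
     (\<And>k t. k < degree p \<Longrightarrow> (f k has_vector_derivative f (Suc k) t) (at t)) \<Longrightarrow>
     (\<And>t. t \<ge> 0 \<Longrightarrow> norm (\<Sum>k\<le>degree p. coeff P k * f k t) \<le> K * exp (- \<delta> * t)) \<Longrightarrow>
     (\<And>k. k < degree p \<Longrightarrow> norm (f k 0) \<le> K) \<Longrightarrow> k \<le> degree p \<Longrightarrow> t \<ge> 0 \<Longrightarrow>
     norm (f k t :: complex) \<le> C * K * exp (- \<delta> * t)"
    using derivatives_exponential_decay[OF P \<delta>(2)] by (auto 0 4 simp: P_def)
  show ?thesis
  proof (rule that[OF C \<delta>(1)])
    fix x K k and t :: real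
    assume x: "linear_ode_solution p x" and ini: "\<And>j. j < degree p \<Longrightarrow> \<bar>(deriv ^^ j) x 0\<bar> \<le> K"
      and K: "0 \<le> K" and k: "k < degree p" and t: "t \<ge> 0"
    have "norm (complex_of_real ((deriv ^^ k) x t)) \<le> C * K * exp (- \<delta> * t)"
    proof (rule bnd[where f = "\<lambda>k t. complex_of_real ((deriv ^^ k) x t)"])
      fix k and t :: real assume "k < degree p"
      hence "(deriv ^^ k) x differentiable (at t)" using x by (auto simp: linear_ode_solution_def)
      hence "((deriv ^^ k) x has_real_derivative (deriv ^^ Suc k) x t) (at t)"
        by (simp add: DERIV_deriv_iff_real_differentiable)
      thus "((\<lambda>t. complex_of_real ((deriv ^^ k) x t)) has_vector_derivative complex_of_real ((deriv ^^ Suc k) x t)) (at t)"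
        by (rule has_vector_derivative_of_real)
    next
      fix t :: real
      have "(\<Sum>k\<le>degree p. coeff P k * complex_of_real ((deriv ^^ k) x t))
          = complex_of_real (\<Sum>k\<le>degree p. coeff p k * (deriv ^^ k) x t)" by (simp add: P_def)
      also have "\<dots> = 0" using x by (simp add: linear_ode_solution_def)
      finally show "norm (\<Sum>k\<le>degree p. coeff P k * complex_of_real ((deriv ^^ k) x t)) \<le> K * exp (- \<delta> * t)"
        using K by simp
    qed (use ini k t in auto)
    thus "\<bar>(deriv ^^ k) x t\<bar> \<le> C * K * exp (- \<delta> * t)" by simp
  qed
qed

lemma zero_globally_asymptotically_stable_if_roots:
  assumes p: "p \<noteq> 0" and neg: "all_roots_neg_Re p"
  shows "zero_globally_asymptotically_stable p"
proof -
  obtain C \<delta> where C: "C \<ge> 0" "\<delta> > 0" and bnd: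
    "\<And>x K k t. linear_ode_solution p x \<Longrightarrow> (\<And>j. j < degree p \<Longrightarrow> \<bar>(deriv ^^ j) x 0\<bar> \<le> K) \<Longrightarrow> 0 \<le> K \<Longrightarrow>
       k < degree p \<Longrightarrow> t \<ge> 0 \<Longrightarrow> \<bar>(deriv ^^ k) x t\<bar> \<le> C * K * exp (- \<delta> * t)"
    using linear_ode_solution_decay[OF assms] by blast
  show ?thesis
    unfolding zero_globally_asymptotically_stable_def zero_lyapunov_stable_def zero_globally_attracting_def
  proof (intro conjI allI impI)
    fix \<epsilon> :: real assume \<epsilon>: "\<epsilon> > 0"
    show "\<exists>\<eta>>0. \<forall>x. linear_ode_solution p x \<longrightarrow> (\<forall>k<degree p. \<bar>(deriv ^^ k) x 0\<bar> < \<eta>) \<longrightarrow>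
        (\<forall>t\<ge>0. \<forall>k<degree p. \<bar>(deriv ^^ k) x t\<bar> < \<epsilon>)"
    \<comment> \<open>The summand 1 covers the case C = 0 and makes the final estimate
      strict.\<close>
    proof (intro exI[of _ "\<epsilon> / (C + 1)"] conjI allI impI)
      show "0 < \<epsilon> / (C + 1)" using C \<epsilon> by simp
      fix x k and t :: real
      assume x: "linear_ode_solution p x" "\<forall>k<degree p. \<bar>(deriv ^^ k) x 0\<bar> < \<epsilon> / (C + 1)" "0 \<le> t" "k < degree p"
      have "\<bar>(deriv ^^ k) x t\<bar> \<le> C * (\<epsilon> / (C + 1)) * exp (- \<delta> * t)"
        using x C \<epsilon> by (intro bnd) (auto intro: less_imp_le)
      also have "\<dots> \<le> C * (\<epsilon> / (C + 1)) * 1" using C \<epsilon> x(3) by (intro mult_left_mono) auto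
      also have "\<dots> < \<epsilon>" using C \<epsilon> by (simp add: field_simps)
      finally show "\<bar>(deriv ^^ k) x t\<bar> < \<epsilon>" .
    qed
  next
    fix x k assume x: "linear_ode_solution p x" and k: "k < degree p"
    define K where "K = (\<Sum>j<degree p. \<bar>(deriv ^^ j) x 0\<bar>)"
    have "\<bar>(deriv ^^ k) x t\<bar> \<le> C * K * exp (- \<delta> * t)" if "t \<ge> 0" for t
      using x k that by (intro bnd) (auto simp: K_def sum_nonneg intro: member_le_sum)
    hence "eventually (\<lambda>t. norm ((deriv ^^ k) x t) \<le> C * K * exp (- \<delta> * t)) at_top"
      by (auto simp: eventually_at_top_linorder)
    moreover have "((\<lambda>t. C * K * exp (- \<delta> * t)) \<longlongrightarrow> 0) at_top"
    proof -
      have "filterlim (\<lambda>t. - \<delta> * t) at_bot at_top"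
        using C(2) by (auto simp: filterlim_uminus_at_bot intro!: filterlim_tendsto_pos_mult_at_top[OF tendsto_const] filterlim_ident)
      hence "((\<lambda>t. exp (- \<delta> * t)) \<longlongrightarrow> 0) at_top" by (rule filterlim_compose[OF exp_at_bot])
      thus ?thesis by (rule tendsto_mult_right_zero)
    qed
    ultimately show "((deriv ^^ k) x \<longlongrightarrow> 0) at_top" by (rule Lim_null_comparison)
  qed
qed

text \<open>A root z with Re z \<ge> 0 produces the real solution Re (exp (z t)), as the
  coefficients are real. Sampled at whole periods of its oscillation it equals exp (Re z * t) \<ge>
  1, so it cannot tend to 0.\<close>

lemma roots_if_zero_globally_attracting:
  assumes p: "p \<noteq> 0" and att: "zero_globally_attracting p"
  shows "all_roots_neg_Re p"
  unfolding all_roots_neg_Re_def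
proof (intro allI impI, rule ccontr)
  fix z assume z: "poly (map_poly complex_of_real p) z = 0" and "\<not> Re z < 0"
  hence Re: "Re z \<ge> 0" by simp
  \<comment> \<open>Positive degree puts k = 0 in the range of the attraction condition, which
    otherwise says nothing about the solution itself.\<close>
  have deg: "degree p > 0"
  proof (rule ccontr)
    assume "\<not> degree p > 0"
    then obtain c where "p = [:c:]" "c \<noteq> 0" using p by (metis degree_eq_zeroE neq0_conv pCons_0_0)
    thus False using z by (simp add: map_poly_pCons)
  qed
  define x where "x t = Re (exp (z * of_real t))" for t
  have D: "((\<lambda>t. Re (z ^ k * exp (z * of_real t))) has_real_derivative Re (z ^ Suc k * exp (z * of_real t))) (at t)" for k t
  proof -
    have "((\<lambda>w. z ^ k * exp (z * w)) has_field_derivative (z ^ Suc k * exp (z * of_real t))) (at (of_real t))"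
      by (auto intro!: derivative_eq_intros)
    from has_vector_derivative_real_field[OF this]
    have "((\<lambda>t. z ^ k * exp (z * of_real t)) has_vector_derivative (z ^ Suc k * exp (z * of_real t))) (at t)" .
    thus ?thesis
      unfolding has_real_derivative_iff_has_vector_derivative
      using bounded_linear.has_vector_derivative[OF bounded_linear_Re] by fastforce
  qed
  have dx: "(deriv ^^ k) x = (\<lambda>t. Re (z ^ k * exp (z * of_real t)))" for k
  proof (induction k)
    case 0 show ?case by (auto simp: x_def)
  next
    case (Suc k)
    have "(deriv ^^ Suc k) x = deriv (\<lambda>t. Re (z ^ k * exp (z * of_real t)))" using Suc by simp
    also have "\<dots> = (\<lambda>t. Re (z ^ Suc k * exp (z * of_real t)))"
      by (rule ext, rule DERIV_imp_deriv, rule D)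
    finally show ?case .
  qed
  have "linear_ode_solution p x"
    unfolding linear_ode_solution_def dx
  proof (intro conjI allI impI)
    fix k t show "(\<lambda>t. Re (z ^ k * exp (z * complex_of_real t))) differentiable at t"
      using D real_differentiable_def by blast
  next
    fix t
    have "0 = Re (poly (map_poly complex_of_real p) z * exp (z * of_real t))" using z by simp
    also have "\<dots> = (\<Sum>k\<le>degree p. coeff p k * Re (z ^ k * exp (z * complex_of_real t)))"
      by (simp add: poly_altdef sum_distrib_right mult.assoc)
    finally show "(\<Sum>k\<le>degree p. coeff p k * Re (z ^ k * exp (z * complex_of_real t))) = 0" by simp
  qed
  hence "(x \<longlongrightarrow> 0) at_top" using att deg unfolding zero_globally_attracting_def by fastforce
  \<comment> \<open>One period of the cosine factor; without oscillation any positive spacing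
    works.\<close>
  define c where "c = (if Im z = 0 then 1 else 2 * pi / \<bar>Im z\<bar>)"
  have c: "c > 0" by (auto simp: c_def)
  have "x (c * real n) \<ge> 1" for n
  proof -
    have "cos (Im z * (c * real n)) = cos \<bar>Im z * (c * real n)\<bar>" by simp
    also have "\<bar>Im z * (c * real n)\<bar> = (if Im z = 0 then 0 else 2 * real n * pi)"
      by (simp add: c_def abs_mult)
    also have "cos \<dots> = 1" by (simp add: cos_2npi)
    finally have "x (c * real n) = exp (Re z * (c * real n))" by (simp add: x_def Re_exp)
    thus ?thesis using Re c by simp
  qed
  moreover have "(\<lambda>n. x (c * real n)) \<longlonglongrightarrow> 0"
    using c by (intro filterlim_compose[OF \<open>(x \<longlongrightarrow> 0) at_top\<close>]
        filterlim_tendsto_pos_mult_at_top[OF tendsto_const] filterlim_real_sequentially) auto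
  ultimately have "(0::real) \<ge> 1" by (intro tendsto_lowerbound) auto
  thus False by simp
qed

text \<open>For p = 0 the degree is 0, so the stability conditions range over no derivative at all
  and hold vacuously, although every complex number is a root.\<close>

lemma zero_globally_asymptotically_stable_iff:
  "zero_globally_asymptotically_stable p \<longleftrightarrow> p = 0 \<or> all_roots_neg_Re p"
proof (cases "p = 0")
  case True
  thus ?thesis
    by (auto simp: zero_globally_asymptotically_stable_def zero_lyapunov_stable_def zero_globally_attracting_def
      intro: exI[of _ 1])
next
  case False
  thus ?thesis
    using zero_globally_asymptotically_stable_if_roots roots_if_zero_globally_attracting
    by (auto simp: zero_globally_asymptotically_stable_def)
qed

subsection \<open>Hurwitz conditions\<close>

lemma map_poly_complex_of_real_mult:
  "map_poly complex_of_real (p * q) = map_poly complex_of_real p * map_poly complex_of_real q"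
  by (intro poly_eqI) (simp add: coeff_map_poly coeff_mult)

lemma map_poly_complex_of_real_add:
  "map_poly complex_of_real (p + q) = map_poly complex_of_real p + map_poly complex_of_real q"
  by (intro poly_eqI) (simp add: coeff_map_poly)

lemma all_roots_neg_Re_mult:
  "all_roots_neg_Re (p * q) \<longleftrightarrow> all_roots_neg_Re p \<and> all_roots_neg_Re q"
  by (auto simp: all_roots_neg_Re_def map_poly_complex_of_real_mult)

lemma poly_map_poly_complex_of_real:
  "poly (map_poly complex_of_real p) (complex_of_real x) = complex_of_real (poly p x)"
  by (induction p) (simp_all add: map_poly_pCons)

lemma poly_eq_if_degree_less_2:
  fixes p :: "'a::zero poly"
  assumes "degree p < 2"
  shows "p = [:coeff p 0, coeff p 1:]"
  using assms by (intro poly_eqI) (auto simp: coeff_pCons coeff_eq_0 split: nat.split)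

text \<open>The divisor is (X - z)(X - cnj z). The remainder is a real polynomial of degree at most
  one that vanishes at the non-real point z: the imaginary part kills its slope, then the real part
  its constant.\<close>

lemma real_quadratic_dvd:
  assumes z: "poly (map_poly complex_of_real p) z = 0" and Im: "Im z \<noteq> 0"
  shows "[:(Re z)\<^sup>2 + (Im z)\<^sup>2, - 2 * Re z, 1:] dvd p"
proof -
  define d where "d = [:(Re z)\<^sup>2 + (Im z)\<^sup>2, - 2 * Re z, 1:]"
  have "poly (map_poly complex_of_real d) z = 0"
    by (simp add: d_def map_poly_pCons complex_eq_iff power2_eq_square algebra_simps)
  moreover have "p = d * (p div d) + p mod d" by simp
  ultimately have r: "poly (map_poly complex_of_real (p mod d)) z = 0"
    using z map_poly_complex_of_real_add map_poly_complex_of_real_mult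
    by (metis (no_types, lifting) add_0 mult_zero_left poly_add poly_mult)
  have d0: "d \<noteq> 0" "degree d = 2" by (simp_all add: d_def)
  hence "p mod d = 0 \<or> degree (p mod d) < 2" using degree_mod_less[of d p] by auto
  hence "degree (p mod d) < 2" by auto
  then obtain a b where ab: "p mod d = [:a, b:]" using poly_eq_if_degree_less_2 by blast
  from r have "complex_of_real a + z * complex_of_real b = 0" by (simp add: ab map_poly_pCons)
  hence "Im z * b = 0" "a + Re z * b = 0" by (auto simp: complex_eq_iff)
  with Im have "a = 0" "b = 0" by auto
  with ab show ?thesis by (simp add: d_def dvd_eq_mod_eq_0)
qed

text \<open>If Re z \<ge> 0, the imaginary part Im z * (b + 2 k Re z) of the equation forces z to be
  real, and a polynomial with positive coefficients has no real root \<ge> 0.\<close>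

lemma hurwitz_quadratic:
  fixes b c k :: real
  assumes "k > 0" "b > 0" "c > 0"
  shows "all_roots_neg_Re [:c, b, k:]"
  unfolding all_roots_neg_Re_def
proof (intro allI impI, rule ccontr)
  fix z :: complex
  assume z: "poly (map_poly complex_of_real [:c, b, k:]) z = 0" and "\<not> Re z < 0"
  hence Re: "Re z \<ge> 0" by simp
  have "Im z * (b + 2 * k * Re z) = 0" and r: "c + Re z * b + k * (Re z)\<^sup>2 = k * (Im z)\<^sup>2"
    using z by (auto simp: map_poly_pCons complex_eq_iff algebra_simps power2_eq_square)
  moreover have "b + 2 * k * Re z > 0" using assms Re by (simp add: add_pos_nonneg)
  ultimately have "Im z = 0" by simp
  with r have "c + Re z * b + k * (Re z)\<^sup>2 = 0" by simp
  moreover have "c + Re z * b + k * (Re z)\<^sup>2 > 0" using assms Re by (intro add_pos_nonneg) auto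
  ultimately show False by simp
qed

section \<open>Positive coefficients and quadratic factors\<close>

definition pos_coeffs :: "real poly \<Rightarrow> bool" where
  "pos_coeffs p \<longleftrightarrow> (\<forall>k\<le>degree p. coeff p k > 0)"

lemma pos_coeffs_mult:
  assumes p: "pos_coeffs p" and q: "pos_coeffs q"
  shows "pos_coeffs (p * q)"
  unfolding pos_coeffs_def
proof (intro allI impI)
  have p0: "p \<noteq> 0" and q0: "q \<noteq> 0" using p q by (auto simp: pos_coeffs_def)
  have nn: "coeff p k \<ge> 0" "coeff q k \<ge> 0" for k
    using p q by (cases "k \<le> degree p"; cases "k \<le> degree q"; force simp: pos_coeffs_def coeff_eq_0)+
  fix k assume "k \<le> degree (p * q)"
  hence "k \<le> degree p + degree q" using p0 q0 by (simp add: degree_mult_eq)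
  \<comment> \<open>All terms of the convolution are nonnegative, so one positive term suffices;
    this index keeps both factors within their degrees.\<close>
  hence i: "min k (degree p) \<le> k" "k - min k (degree p) \<le> degree q" by auto
  have "0 < coeff p (min k (degree p)) * coeff q (k - min k (degree p))"
    using p q i by (auto simp: pos_coeffs_def)
  also have "\<dots> \<le> (\<Sum>i\<le>k. coeff p i * coeff q (k - i))"
    using nn i by (intro member_le_sum) auto
  finally show "0 < coeff (p * q) k" by (simp add: coeff_mult)
qed

lemma pos_coeffs_pCons:
  assumes "p \<noteq> 0"
  shows "pos_coeffs (pCons a p) \<longleftrightarrow> a > 0 \<and> pos_coeffs p"
proof -
  have "(\<forall>k\<le>Suc n. P k) \<longleftrightarrow> P 0 \<and> (\<forall>k\<le>n. P (Suc k))" for n and P :: "nat \<Rightarrow> bool"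
    by (metis Suc_le_mono le0 not0_implies_Suc)
  thus ?thesis using assms by (simp add: pos_coeffs_def)
qed

lemma pos_coeffs_const: "pos_coeffs [:a:] \<longleftrightarrow> a > 0"
  by (simp add: pos_coeffs_def)


text \<open>A root z gives the factor X - z if it is real and (X - z)(X - cnj z) otherwise; Re z < 0
  makes the coefficients positive. The factor is monic, so the cofactor inherits the leading
  coefficient.\<close>

lemma pos_coeffs_factor:
  assumes s: "all_roots_neg_Re p" and d: "degree p > 0"
  obtains f q where "p = f * q" "pos_coeffs f" "all_roots_neg_Re q"
    "(\<exists>e. f = [:e, 1:]) \<or> (\<exists>c b. f = [:c, b, 1:])"
proof -
  have "\<not> constant (poly (map_poly complex_of_real p))" using d by (simp add: constant_degree)
  then obtain z where z: "poly (map_poly complex_of_real p) z = 0"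
    using fundamental_theorem_of_algebra by blast
  have Re: "Re z < 0" using s z by (auto simp: all_roots_neg_Re_def)
  show ?thesis
  proof (cases "Im z = 0")
    case True
    hence "z = complex_of_real (Re z)" by (simp add: complex_eq_iff)
    hence "poly p (Re z) = 0" using z by (metis of_real_eq_0_iff poly_map_poly_complex_of_real)
    then obtain q where q: "p = [:- Re z, 1:] * q" by (metis dvdE poly_eq_0_iff_dvd)
    have "all_roots_neg_Re q" using s unfolding q all_roots_neg_Re_mult by simp
    moreover have "pos_coeffs [:- Re z, 1:]" using Re by (simp add: pos_coeffs_pCons pos_coeffs_const)
    ultimately show ?thesis using that[OF q] by blast
  next
    case False
    from real_quadratic_dvd[OF z this]
    obtain q where q: "p = [:(Re z)\<^sup>2 + (Im z)\<^sup>2, - 2 * Re z, 1:] * q" by (elim dvdE)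
    have "(Re z)\<^sup>2 + (Im z)\<^sup>2 > 0" using False by (simp add: sum_power2_gt_zero_iff)
    hence "pos_coeffs [:(Re z)\<^sup>2 + (Im z)\<^sup>2, - 2 * Re z, 1:]" using Re by (simp add: pos_coeffs_pCons pos_coeffs_const)
    moreover have "all_roots_neg_Re q" using s unfolding q all_roots_neg_Re_mult by simp
    ultimately show ?thesis using that[OF q] by blast
  qed
qed

lemma pos_coeffs_if_all_roots_neg_Re:
  assumes "all_roots_neg_Re p" "lead_coeff p > 0"
  shows "pos_coeffs p"
  using assms
proof (induction "degree p" arbitrary: p rule: less_induct)
  case less
  show ?case
  proof (cases "degree p = 0")
    case True
    thus ?thesis using less.prems by (simp add: pos_coeffs_def)
  next
    case False
    then obtain f q where f: "p = f * q" "pos_coeffs f" "all_roots_neg_Re q"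
        "(\<exists>e. f = [:e, 1:]) \<or> (\<exists>c b. f = [:c, b, 1:])"
      using pos_coeffs_factor[OF less.prems(1)] by blast
    have f0: "degree f > 0" "lead_coeff f = 1" using f(4) by auto
    have q0: "q \<noteq> 0" "f \<noteq> 0" using less.prems(2) f(1) by auto
    have "lead_coeff q > 0" using less.prems(2) f0(2) unfolding f(1) lead_coeff_mult by simp
    moreover have "degree q < degree p" using f0 q0 unfolding f(1) by (simp add: degree_mult_eq)
    ultimately have "pos_coeffs q" using f(3) by (intro less.hyps)
    thus ?thesis using f pos_coeffs_mult by blast
  qed
qed

text \<open>Allows a single parametrisation in degrees three and four, without distinguishing real
  from complex roots. If the first factor found is linear, a factor of the cofactor is either
  already quadratic or again linear, and two linear factors are multiplied together.\<close>

lemma quadratic_factor: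
  assumes s: "all_roots_neg_Re p" and l: "lead_coeff p > 0" and d: "degree p \<ge> 2"
  obtains b c q where "p = [:c, b, 1:] * q" "b > 0" "c > 0" "pos_coeffs q" "degree q = degree p - 2"
proof -
  from d have "degree p > 0" by simp
  then obtain f q where f: "p = f * q" "pos_coeffs f" "all_roots_neg_Re q"
      "(\<exists>e. f = [:e, 1:]) \<or> (\<exists>c b. f = [:c, b, 1:])"
    using pos_coeffs_factor[OF s] by blast
  have lf: "lead_coeff f = 1" using f(4) by auto
  hence lq: "lead_coeff q > 0" using l unfolding f(1) lead_coeff_mult by simp
  have q0: "q \<noteq> 0" using lq by auto
  consider (quad) c b where "f = [:c, b, 1:]" | (lin) e where "f = [:e, 1:]" using f(4) by blast
  thus ?thesis
  proof cases
    case quad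
    have "b > 0" "c > 0" using f(2) unfolding quad by (simp_all add: pos_coeffs_pCons pos_coeffs_const)
    moreover have "pos_coeffs q" using f(3) lq by (rule pos_coeffs_if_all_roots_neg_Re)
    moreover have "degree q = degree p - 2" using q0 unfolding f(1) quad by (subst degree_mult_eq) auto
    ultimately show ?thesis using that f(1) quad by blast
  next
    case lin
    have e: "e > 0" using f(2) unfolding lin by (simp add: pos_coeffs_pCons pos_coeffs_const)
    have dp: "degree p = Suc (degree q)" using q0 unfolding f(1) lin by (subst degree_mult_eq) auto
    hence "degree q > 0" using d by simp
    then obtain f' q' where f': "q = f' * q'" "pos_coeffs f'" "all_roots_neg_Re q'"
        "(\<exists>e. f' = [:e, 1:]) \<or> (\<exists>c b. f' = [:c, b, 1:])"
      using pos_coeffs_factor[OF f(3)] by blast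
    have lf': "lead_coeff f' = 1" using f'(4) by auto
    hence lq': "lead_coeff q' > 0" using lq unfolding f'(1) lead_coeff_mult by simp
    have q0': "q' \<noteq> 0" using lq' by auto
    have pq': "pos_coeffs q'" using f'(3) lq' by (rule pos_coeffs_if_all_roots_neg_Re)
    consider (quad') c b where "f' = [:c, b, 1:]" | (lin') e' where "f' = [:e', 1:]" using f'(4) by blast
    thus ?thesis
    proof cases
      case quad'
      have "b > 0" "c > 0" using f'(2) unfolding quad' by (simp_all add: pos_coeffs_pCons pos_coeffs_const)
      moreover have "pos_coeffs (f * q')" using f(2) pq' by (rule pos_coeffs_mult)
      moreover have "p = [:c, b, 1:] * (f * q')" using f(1) f'(1) quad' by (simp only: mult_ac)
      moreover from this have "degree (f * q') = degree p - 2"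
        using q0' lf unfolding \<open>p = [:c, b, 1:] * (f * q')\<close> by (subst (2) degree_mult_eq) auto
      ultimately show ?thesis using that by blast
    next
      case lin'
      have e': "e' > 0" using f'(2) unfolding lin' by (simp add: pos_coeffs_pCons pos_coeffs_const)
      have "p = [:e * e', e + e', 1:] * q'"
      proof -
        have "[:e, 1:] * [:e', 1:] = [:e * e', e + e', 1:]" by simp
        thus ?thesis unfolding f(1) f'(1) lin lin' by (simp only: mult.assoc[symmetric])
      qed
      moreover have "degree q' = degree p - 2"
        using q0' unfolding \<open>p = [:e * e', e + e', 1:] * q'\<close> by (subst degree_mult_eq) auto
      ultimately show ?thesis using that e e' pq' by (metis add_pos_pos mult_pos_pos)
    qed
  qed
qed

text \<open>Both directions compute a1 a2 - a0 a3 from a factorisation. With (X^2 + b X + c)(e X +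
  d) and positive parameters it is a positive sum. Conversely, a non-real root with real part u
  \<ge> 0 and squared modulus m gives -2 u (e^2 m + d a2) \<le> 0, while real roots \<ge> 0 are
  excluded by positivity.\<close>

lemma hurwitz_cubic:
  assumes a: "a0 > 0" "a1 > 0" "a2 > 0" "a3 > (0::real)"
  shows "all_roots_neg_Re [:a0, a1, a2, a3:] \<longleftrightarrow> a0 * a3 < a1 * a2"
proof
  assume s: "all_roots_neg_Re [:a0, a1, a2, a3:]"
  obtain b c q where q: "[:a0, a1, a2, a3:] = [:c, b, 1:] * q" "b > 0" "c > 0" "pos_coeffs q"
      "degree q = degree [:a0, a1, a2, a3:] - 2"
  proof (rule quadratic_factor[OF s])
    show "lead_coeff [:a0, a1, a2, a3:] > 0" "degree [:a0, a1, a2, a3:] \<ge> 2" using a by simp_all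
  qed
  have dq: "degree q = 1" using q(5) a by simp
  then obtain d e where de: "q = [:d, e:]"  using dq poly_eq_if_degree_less_2[of q] by auto
  have pos: "d > 0" "e > 0" using q(4) dq unfolding de by (cases "e = 0"; simp add: pos_coeffs_pCons pos_coeffs_const)+
  have "a0 = c * d" "a1 = c * e + b * d" "a2 = d + b * e" "a3 = e"
    using q(1) unfolding de by (auto simp: algebra_simps)
  moreover from this have "a1 * a2 - a0 * a3 = b * (c * e * e + d * d + b * d * e)"
    by (simp add: algebra_simps)
  moreover have "\<dots> > 0" using pos q by (intro mult_pos_pos add_pos_pos) auto
  ultimately show "a0 * a3 < a1 * a2" by linarith
next
  assume lt: "a0 * a3 < a1 * a2"
  show "all_roots_neg_Re [:a0, a1, a2, a3:]"
    unfolding all_roots_neg_Re_def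
  proof (intro allI impI, rule ccontr)
    fix z assume z: "poly (map_poly complex_of_real [:a0, a1, a2, a3:]) z = 0" and "\<not> Re z < 0"
    hence Re: "Re z \<ge> 0" by simp
    show False
    proof (cases "Im z = 0")
      case True
      hence "z = complex_of_real (Re z)" by (simp add: complex_eq_iff)
      hence "poly [:a0, a1, a2, a3:] (Re z) = 0" using z by (metis of_real_eq_0_iff poly_map_poly_complex_of_real)
      moreover have "poly [:a0, a1, a2, a3:] (Re z) > 0"
        using Re a by (auto intro!: add_pos_nonneg mult_nonneg_nonneg add_nonneg_nonneg)
      ultimately show False by simp
    next
      case False
      define u m where "u = Re z" and "m = (Re z)\<^sup>2 + (Im z)\<^sup>2"
      have m: "m > 0" using False by (simp add: m_def sum_power2_gt_zero_iff)
      obtain q where q: "[:a0, a1, a2, a3:] = [:m, - 2 * u, 1:] * q"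
        using real_quadratic_dvd[OF z False] unfolding m_def u_def by (elim dvdE)
      have q0: "q \<noteq> 0" using q a by auto
      have "degree [:a0, a1, a2, a3:] = 3" using a by simp
      hence dq: "degree q = 1" using q0 unfolding q by (subst (asm) degree_mult_eq) auto
      then obtain d e where de: "q = [:d, e:]" using dq poly_eq_if_degree_less_2[of q] by auto
      have c: "a0 = m * d" "a1 = m * e - 2 * u * d" "a2 = d - 2 * u * e" "a3 = e"
        using q unfolding de by (auto simp: algebra_simps)
      \<comment> \<open>The root is not in the left half-plane here, so the sign of \<open>d\<close>
        has to be read off from a0 = m d.\<close>
      hence d: "d > 0" using a m by (simp add: zero_less_mult_iff)
      have "a1 * a2 - a0 * a3 = - (2 * u) * (e * e * m + d * a2)"
        unfolding c by (simp add: algebra_simps)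
      moreover have "2 * u * (e * e * m + d * a2) \<ge> 0"
        using Re a c(4) d m by (intro mult_nonneg_nonneg add_nonneg_nonneg) (auto simp: u_def)
      ultimately show False using lt by simp
    qed
  qed
qed

text \<open>For (X^2 + b X + c)(k X^2 + e X + d) with positive parameters, both differences expand
  into positive monomials. The two inequalities mirror each other: reversing the coefficients
  replaces each root z by 1/z, which preserves the left half-plane.\<close>

lemma hurwitz_quartic_necessary:
  assumes s: "all_roots_neg_Re [:a0, a1, a2, a3, a4:]" and a: "a4 > (0::real)"
  shows "a0 * a3 < a1 * a2" "a1 * a4 < a2 * a3"
proof -
  obtain b c q where q: "[:a0, a1, a2, a3, a4:] = [:c, b, 1:] * q" "b > 0" "c > 0" "pos_coeffs q"
      "degree q = degree [:a0, a1, a2, a3, a4:] - 2"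
  proof (rule quadratic_factor[OF s])
    show "lead_coeff [:a0, a1, a2, a3, a4:] > 0" "degree [:a0, a1, a2, a3, a4:] \<ge> 2" using a by simp_all
  qed
  have dq: "degree q = 2" using q(5) a by simp
  have q': "q = [:coeff q 0, coeff q 1, coeff q 2:]"
    using dq by (intro poly_eqI) (auto simp: coeff_pCons numeral_2_eq_2 coeff_eq_0 split: nat.split)
  define d e k where "d = coeff q 0" and "e = coeff q 1" and "k = coeff q 2"
  have pos: "d > 0" "e > 0" "k > 0" using q(4) dq by (auto simp: d_def e_def k_def pos_coeffs_def)
  have qd: "q = [:d, e, k:]" using q' by (simp add: d_def e_def k_def)
  have c: "a0 = c * d" "a1 = b * d + c * e" "a2 = c * k + b * e + d" "a3 = b * k + e" "a4 = k"
    using q(1) unfolding qd by (auto simp: algebra_simps)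
  have "a1 * a2 - a0 * a3 = b * b * d * e + b * d * d + c * c * e * k + b * c * e * e"
    unfolding c by (simp add: algebra_simps)
  moreover have "\<dots> > 0" using pos q by (intro add_pos_pos mult_pos_pos) auto
  ultimately show "a0 * a3 < a1 * a2" by linarith
  have "a2 * a3 - a1 * a4 = c * b * k * k + b * b * e * k + b * e * e + d * e"
    unfolding c by (simp add: algebra_simps)
  moreover have "\<dots> > 0" using pos q by (intro add_pos_pos mult_pos_pos) auto
  ultimately show "a1 * a4 < a2 * a3" by linarith
qed

section \<open>Root criteria for coefficient vectors\<close>

lemma coeff_poly_of_coeffs: "coeff (poly_of_coeffs n a) k = (if k \<le> n then a k else 0)"
  by (auto simp: poly_of_coeffs_def coeff_sum)

lemma degree_poly_of_coeffs:
  assumes "a n \<noteq> 0"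
  shows "degree (poly_of_coeffs n a) = n"
proof (rule antisym)
  show "degree (poly_of_coeffs n a) \<le> n" by (rule degree_le) (simp add: coeff_poly_of_coeffs)
  show "n \<le> degree (poly_of_coeffs n a)" using assms by (intro le_degree) (simp add: coeff_poly_of_coeffs)
qed

lemma poly_of_coeffs_uminus: "poly_of_coeffs n (\<lambda>k. - a k) = - poly_of_coeffs n a"
  by (rule poly_eqI) (simp add: coeff_poly_of_coeffs)

text \<open>The degenerate case of the recursion that later shows the root event to be
  measurable.\<close>

lemma poly_of_coeffs_Suc_eq:
  "a (Suc n) = 0 \<Longrightarrow> poly_of_coeffs (Suc n) a = poly_of_coeffs n a"
  by (simp add: poly_of_coeffs_def)

lemma all_roots_neg_Re_uminus: "all_roots_neg_Re (- p) \<longleftrightarrow> all_roots_neg_Re p"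
  using all_roots_neg_Re_mult[of "[:- 1:]" p] by (simp add: all_roots_neg_Re_def map_poly_pCons)

definition same_sign :: "nat \<Rightarrow> (nat \<Rightarrow> real) \<Rightarrow> bool" where
  "same_sign n a \<longleftrightarrow> (\<forall>k\<le>n. a k > 0) \<or> (\<forall>k\<le>n. a k < 0)"

text \<open>Negating the polynomial keeps its roots, so a positive leading coefficient may be
  assumed. The condition on \<open>a n\<close> fixes the degree: otherwise trailing zeros would be
  hidden by positivity up to a smaller degree.\<close>

lemma same_sign_if_all_roots_neg_Re:
  assumes "all_roots_neg_Re (poly_of_coeffs n a)" "a n \<noteq> 0"
  shows "same_sign n a"
proof -
  have *: "\<forall>k\<le>n. b k > 0" if "all_roots_neg_Re (poly_of_coeffs n b)" "b n > 0" for b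
    using pos_coeffs_if_all_roots_neg_Re[OF that(1)] degree_poly_of_coeffs[of b n] that(2)
    by (auto simp: pos_coeffs_def coeff_poly_of_coeffs)
  show ?thesis
    using *[of a] *[of "\<lambda>k. - a k"] assms
    by (cases "a n > 0") (auto simp: same_sign_def poly_of_coeffs_uminus all_roots_neg_Re_uminus)
qed

text \<open>A nonzero constant has no roots, whereas 0 is a root of the zero polynomial.\<close>

lemma all_roots_neg_Re_0: "all_roots_neg_Re (poly_of_coeffs 0 a) \<longleftrightarrow> a 0 \<noteq> 0"
  by (auto simp: all_roots_neg_Re_def poly_of_coeffs_def monom_0 map_poly_pCons dest: spec[of _ 0])

lemma all_roots_neg_Re_1:
  assumes "a 1 \<noteq> 0"
  shows "all_roots_neg_Re (poly_of_coeffs 1 a) \<longleftrightarrow> same_sign 1 a"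
proof
  show "same_sign 1 a" if "all_roots_neg_Re (poly_of_coeffs 1 a)"
    using same_sign_if_all_roots_neg_Re[of 1 a] that assms by simp
  have *: "all_roots_neg_Re (poly_of_coeffs 1 b)" if "\<forall>k\<le>1. b k > 0" for b
  proof -
    have pos: "b 0 > 0" "b 1 > 0" using that by auto
    show ?thesis unfolding all_roots_neg_Re_def
    proof (intro allI impI)
      fix z assume "poly (map_poly complex_of_real (poly_of_coeffs 1 b)) z = 0"
      hence "b 0 + Re z * b 1 = 0"
        by (simp add: poly_of_coeffs_def monom_altdef map_poly_pCons complex_eq_iff)
      hence "Re z * b 1 < 0" using pos by linarith
      thus "Re z < 0" using pos by (simp add: mult_less_0_iff)
    qed
  qed
  show "all_roots_neg_Re (poly_of_coeffs 1 a)" if "same_sign 1 a"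
    using that *[of a] *[of "\<lambda>k. - a k"]
    by (auto simp: same_sign_def poly_of_coeffs_uminus all_roots_neg_Re_uminus)
qed

lemma poly_of_coeffs_2: "poly_of_coeffs 2 a = [:a 0, a 1, a 2:]"
  by (rule poly_eqI) (auto simp: coeff_poly_of_coeffs coeff_pCons numeral_2_eq_2 le_Suc_eq split: nat.splits)

lemma poly_of_coeffs_3: "poly_of_coeffs 3 a = [:a 0, a 1, a 2, a 3:]"
  by (rule poly_eqI) (auto simp: coeff_poly_of_coeffs coeff_pCons eval_nat_numeral le_Suc_eq split: nat.splits)

lemma poly_of_coeffs_4: "poly_of_coeffs 4 a = [:a 0, a 1, a 2, a 3, a 4:]"
  by (rule poly_eqI) (auto simp: coeff_poly_of_coeffs coeff_pCons eval_nat_numeral le_Suc_eq split: nat.splits)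

lemma all_roots_neg_Re_2:
  assumes "a 2 \<noteq> 0"
  shows "all_roots_neg_Re (poly_of_coeffs 2 a) \<longleftrightarrow> same_sign 2 a"
proof
  show "same_sign 2 a" if "all_roots_neg_Re (poly_of_coeffs 2 a)"
    using same_sign_if_all_roots_neg_Re[of 2 a] that assms by simp
  show "all_roots_neg_Re (poly_of_coeffs 2 a)" if "same_sign 2 a"
    using that hurwitz_quadratic[of "a 2" "a 1" "a 0"]
      hurwitz_quadratic[of "- a 2" "- a 1" "- a 0"]
      all_roots_neg_Re_uminus[of "[:a 0, a 1, a 2:]"]
    by (auto simp: same_sign_def poly_of_coeffs_2)
qed

text \<open>The inequality is homogeneous of degree two, hence unchanged by negating all
  coefficients, so the criterion for positive coefficients covers both signs.\<close>

lemma all_roots_neg_Re_3: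
  assumes "a 3 \<noteq> 0"
  shows "all_roots_neg_Re (poly_of_coeffs 3 a) \<longleftrightarrow> same_sign 3 a \<and> a 0 * a 3 < a 1 * a 2"
proof -
  have "all_roots_neg_Re (poly_of_coeffs 3 a) \<longleftrightarrow> a 0 * a 3 < a 1 * a 2" if "same_sign 3 a"
    using that hurwitz_cubic[of "a 0" "a 1" "a 2" "a 3"] hurwitz_cubic[of "- a 0" "- a 1" "- a 2" "- a 3"]
      all_roots_neg_Re_uminus[of "[:a 0, a 1, a 2, a 3:]"]
    by (auto simp: same_sign_def poly_of_coeffs_3)
  thus ?thesis using same_sign_if_all_roots_neg_Re[of 3 a] assms by blast
qed

lemma all_roots_neg_Re_4:
  assumes "all_roots_neg_Re (poly_of_coeffs 4 a)" "a 4 \<noteq> 0"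
  shows "same_sign 4 a" "a 0 * a 3 < a 1 * a 2" "a 1 * a 4 < a 2 * a 3"
proof -
  show "same_sign 4 a" using same_sign_if_all_roots_neg_Re assms by blast
  have *: "b 0 * b 3 < b 1 * b 2 \<and> b 1 * b 4 < b 2 * b 3"
    if "all_roots_neg_Re (poly_of_coeffs 4 b)" "b 4 > 0" for b
    using hurwitz_quartic_necessary that by (auto simp: poly_of_coeffs_4)
  have "a 0 * a 3 < a 1 * a 2 \<and> a 1 * a 4 < a 2 * a 3"
    using *[of a] *[of "\<lambda>k. - a k"] assms
    by (cases "a 4 > 0") (auto simp: poly_of_coeffs_uminus all_roots_neg_Re_uminus)
  thus "a 0 * a 3 < a 1 * a 2" "a 1 * a 4 < a 2 * a 3" by auto
qed

subsection \<open>Gaussian coefficients\<close>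

text \<open>By independence the pair has a product law, and each section of the diagonal at a fixed
  value of \<open>V\<close> is a single point, which is null for the law of
  \<open>U\<close>.\<close>

lemma (in prob_space) indep_var_AE_neq:
  fixes U V :: "'a \<Rightarrow> real"
  assumes ind: "indep_var borel U borel V" and U: "\<And>c. prob {\<omega> \<in> space M. U \<omega> = c} = 0"
  shows "AE \<omega> in M. U \<omega> \<noteq> V \<omega>"
proof -
  have [measurable]: "U \<in> borel_measurable M" "V \<in> borel_measurable M"
    using indep_var_rv1[OF ind] indep_var_rv2[OF ind] by auto
  define D where "D = {w \<in> space (borel \<Otimes>\<^sub>M borel). fst w = (snd w :: real)}"
  have [measurable]: "D \<in> sets (borel \<Otimes>\<^sub>M borel)"
    unfolding D_def by (rule borel_measurable_eq; measurable)
  interpret U: prob_space "distr M borel U" by (rule prob_space_distr) simp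
  interpret V: prob_space "distr M borel V" by (rule prob_space_distr) simp
  interpret UV: pair_sigma_finite "distr M borel U" "distr M borel V" ..
  have z: "emeasure (distr M borel U) ((\<lambda>x. (x, y)) -` D) = 0" for y
  proof -
    have "(\<lambda>x. (x, y)) -` D = {y}" by (auto simp: D_def space_pair_measure)
    thus ?thesis using U[of y] by (simp add: emeasure_distr emeasure_eq_measure vimage_def Int_def conj_commute)
  qed
  have "emeasure M {\<omega> \<in> space M. U \<omega> = V \<omega>} = emeasure (distr M (borel \<Otimes>\<^sub>M borel) (\<lambda>\<omega>. (U \<omega>, V \<omega>))) D"
  proof -
    have "(\<lambda>\<omega>. (U \<omega>, V \<omega>)) -` D \<inter> space M = {\<omega> \<in> space M. U \<omega> = V \<omega>}"
      by (auto simp: D_def space_pair_measure)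
    thus ?thesis by (subst emeasure_distr) simp_all
  qed
  also have "\<dots> = emeasure (distr M borel U \<Otimes>\<^sub>M distr M borel V) D"
    using ind by (simp add: indep_var_distribution_eq)
  also have "\<dots> = 0"
    by (subst UV.emeasure_pair_measure_alt2) (simp_all add: z)
  finally show ?thesis by (subst AE_iff_measurable[OF _ refl]) auto
qed

text \<open>Fixes a single degree, because the coefficients for different degrees may live on
  different probability spaces.\<close>

locale gaussian_coeffs = prob_space M for M :: "'a measure" +
  fixes n :: nat and X :: "nat \<Rightarrow> 'a \<Rightarrow> real"
  assumes indep: "indep_vars (\<lambda>_. borel) X {0..n}"
    and normal: "k \<le> n \<Longrightarrow> distributed M lborel (X k) (normal_density 0 1)"
begin

lemma random_variable_coeff [measurable]: "k \<le> n \<Longrightarrow> X k \<in> borel_measurable M"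
  using distributed_measurable[OF normal] by simp

lemma emeasure_coeff:
  "k \<le> n \<Longrightarrow> B \<in> sets borel \<Longrightarrow>
    emeasure M {\<omega> \<in> space M. X k \<omega> \<in> B} = (\<integral>\<^sup>+x. ennreal (normal_density 0 1 x) * indicator B x \<partial>lborel)"
  using distributed_emeasure[OF normal, of k B] by (simp add: vimage_def Int_def conj_commute)

lemma prob_coeff_eq: "k \<le> n \<Longrightarrow> prob {\<omega> \<in> space M. X k \<omega> = c} = 0"
  using emeasure_coeff[of k "{c}"] nn_integral_null_set[of "{c}" lborel "\<lambda>x. ennreal (normal_density 0 1 x)"]
  by (simp add: measure_def)

lemma AE_coeff_neq: "k \<le> n \<Longrightarrow> AE \<omega> in M. X k \<omega> \<noteq> c"
  using prob_coeff_eq[of k c] by (subst AE_iff_measurable[OF _ refl]) (auto simp: emeasure_eq_measure)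

text \<open>The normal density is positive everywhere, so probability 0 would make the interval
  Lebesgue-null.\<close>

lemma prob_coeff_open_interval_pos:
  assumes k: "k \<le> n" and lu: "l < u"
  shows "prob {\<omega> \<in> space M. X k \<omega> \<in> {l<..<u}} > 0"
proof (rule ccontr)
  assume "\<not> ?thesis"
  hence "prob {\<omega> \<in> space M. X k \<omega> \<in> {l<..<u}} = 0"
    using measure_nonneg not_le_imp_less antisym by (metis (no_types, lifting))
  hence "(\<integral>\<^sup>+x. ennreal (normal_density 0 1 x) * indicator {l<..<u} x \<partial>lborel) = 0"
    using emeasure_coeff[OF k, of "{l<..<u}"] by (simp add: emeasure_eq_measure)
  hence "AE x in lborel. ennreal (normal_density 0 1 x) * indicator {l<..<u} x = 0"
    by (subst (asm) nn_integral_0_iff_AE) auto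
  hence "AE x in lborel. x \<notin> {l<..<u}"
  proof eventually_elim
    case (elim x)
    have "normal_density 0 1 x > 0" by (rule normal_density_pos) simp
    thus ?case using elim by (auto simp: indicator_def ennreal_eq_0_iff split: if_splits)
  qed
  hence "emeasure lborel {x. l < x \<and> x < u} = 0"
    by (subst (asm) AE_iff_measurable[OF _ refl]) auto
  moreover have "{x. l < x \<and> x < u} = {l<..<u}" by auto
  ultimately show False using lu by simp
qed

text \<open>The affine map with factor -1 shows that \<open>X k\<close> and its negative have the
  same law, and the value 0 has probability 0.\<close>

lemma prob_coeff_pos_neg:
  assumes k: "k \<le> n"
  shows "prob {\<omega> \<in> space M. X k \<omega> > 0} = 1 / 2" "prob {\<omega> \<in> space M. X k \<omega> < 0} = 1 / 2"
proof -
  note [measurable] = random_variable_coeff[OF k]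
  have "distributed M lborel (\<lambda>\<omega>. 0 + (- 1) * X k \<omega>) (normal_density (0 + (- 1) * 0) (\<bar>- 1\<bar> * 1))"
    by (rule normal_density_affine[OF normal[OF k]]) auto
  hence "distributed M lborel (\<lambda>\<omega>. - X k \<omega>) (normal_density 0 1)" by simp
  from distributed_emeasure[OF this, of "{0<..}"]
  have "emeasure M {\<omega> \<in> space M. X k \<omega> < 0} = emeasure M {\<omega> \<in> space M. X k \<omega> > 0}"
    using emeasure_coeff[OF k, of "{0<..}"] by (simp add: vimage_def Int_def conj_commute)
  hence eq: "prob {\<omega> \<in> space M. X k \<omega> < 0} = prob {\<omega> \<in> space M. X k \<omega> > 0}"
    by (simp add: measure_def)
  have "1 = prob {\<omega> \<in> space M. X k \<omega> < 0 \<or> X k \<omega> > 0}"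
    using AE_coeff_neq[OF k, of 0] by (subst prob_eq_1[THEN iffD2]) (auto simp: neq_iff)
  also have "{\<omega> \<in> space M. X k \<omega> < 0 \<or> X k \<omega> > 0} = {\<omega> \<in> space M. X k \<omega> < 0} \<union> {\<omega> \<in> space M. X k \<omega> > 0}" by auto
  also have "prob \<dots> = prob {\<omega> \<in> space M. X k \<omega> < 0} + prob {\<omega> \<in> space M. X k \<omega> > 0}"
    by (rule finite_measure_Union) auto
  finally show "prob {\<omega> \<in> space M. X k \<omega> > 0} = 1 / 2" "prob {\<omega> \<in> space M. X k \<omega> < 0} = 1 / 2"
    using eq by auto
qed

section \<open>Joint law of the coefficients and exchangeability\<close>

lemma prob_all_coeffs:
  assumes "\<And>k. k \<le> n \<Longrightarrow> B k \<in> sets borel"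
  shows "prob {\<omega> \<in> space M. \<forall>k\<le>n. X k \<omega> \<in> B k} = (\<Prod>k\<le>n. prob {\<omega> \<in> space M. X k \<omega> \<in> B k})"
proof -
  have pre: "X k -` B k \<inter> space M = {\<omega> \<in> space M. X k \<omega> \<in> B k}" for k by auto
  have "{\<omega> \<in> space M. \<forall>k\<le>n. X k \<omega> \<in> B k} = (\<Inter>k\<in>{0..n}. X k -` B k \<inter> space M)" by auto
  also have "prob \<dots> = (\<Prod>k\<in>{0..n}. prob (X k -` B k \<inter> space M))"
    by (rule indep_varsD_finite[OF indep]) (simp_all add: assms)
  finally show ?thesis unfolding pre atLeast0AtMost .
qed

lemma pred_all_coeffs:
  assumes "\<And>k. k \<le> n \<Longrightarrow> B k \<in> sets borel"
  shows "Measurable.pred M (\<lambda>\<omega>. \<forall>k\<le>n. X k \<omega> \<in> B k)"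
proof -
  have "Measurable.pred M (\<lambda>\<omega>. X k \<omega> \<in> B k)" if "k \<in> {..n}" for k
    using that by (intro pred_sets2[OF assms random_variable_coeff]) simp_all
  hence "Measurable.pred M (\<lambda>\<omega>. \<forall>k\<in>{..n}. X k \<omega> \<in> B k)" by (intro pred_intros_finite(3)) simp_all
  thus ?thesis by (simp only: Ball_def atMost_iff)
qed

lemma pred_same_sign:
  assumes "m \<le> n"
  shows "Measurable.pred M (\<lambda>\<omega>. same_sign m (\<lambda>k. X k \<omega>))"
proof -
  have [measurable]: "X k \<in> borel_measurable M" if "k \<in> {..m}" for k using that assms by simp
  have "Measurable.pred M (\<lambda>\<omega>. (\<forall>k\<in>{..m}. X k \<omega> > 0) \<or> (\<forall>k\<in>{..m}. X k \<omega> < 0))" by measurable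
  thus ?thesis by (simp add: same_sign_def Ball_def)
qed

lemma prob_same_sign: "prob {\<omega> \<in> space M. same_sign n (\<lambda>k. X k \<omega>)} = 1 / 2 ^ n"
proof -
  have "{\<omega> \<in> space M. same_sign n (\<lambda>k. X k \<omega>)}
      = {\<omega> \<in> space M. \<forall>k\<le>n. X k \<omega> \<in> {0<..}} \<union> {\<omega> \<in> space M. \<forall>k\<le>n. X k \<omega> \<in> {..<0}}"
    by (auto simp: same_sign_def)
  also have "prob \<dots> = prob {\<omega> \<in> space M. \<forall>k\<le>n. X k \<omega> \<in> {0<..}} + prob {\<omega> \<in> space M. \<forall>k\<le>n. X k \<omega> \<in> {..<0}}"
  proof (rule finite_measure_Union)
    show "{\<omega> \<in> space M. \<forall>k\<le>n. X k \<omega> \<in> {0<..}} \<in> events" "{\<omega> \<in> space M. \<forall>k\<le>n. X k \<omega> \<in> {..<0}} \<in> events"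
      using pred_all_coeffs[of "\<lambda>_. {0<..}"] pred_all_coeffs[of "\<lambda>_. {..<0}"] by simp_all
    have "\<not> (\<forall>k\<le>n. X k \<omega> \<in> {..<0})" if "\<forall>k\<le>n. X k \<omega> \<in> {0<..}" for \<omega>
      using that not_less_iff_gr_or_eq by fastforce
    thus "{\<omega> \<in> space M. \<forall>k\<le>n. X k \<omega> \<in> {0<..}} \<inter> {\<omega> \<in> space M. \<forall>k\<le>n. X k \<omega> \<in> {..<0}} = {}"
      by blast
  qed
  \<comment> \<open>A polynomial of degree n has n + 1 coefficients; the two signs give back one
    factor 2.\<close>
  also have "\<dots> = (1 / 2) ^ Suc n + (1 / 2) ^ Suc n"
    by (subst (1 2) prob_all_coeffs) (simp_all add: prob_coeff_pos_neg)
  finally show ?thesis by (simp add: power_one_over)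
qed

lemma distr_coeff: "k \<le> n \<Longrightarrow> distr M borel (X k) = density lborel (normal_density 0 1)"
  using distributed_distr_eq_density[OF normal, of k] distr_cong[of M M borel lborel "X k" "X k"] by simp

text \<open>Injectivity of \<open>\<sigma>\<close> makes the singleton index blocks {\<sigma> j}
  disjoint, and disjoint blocks of an independent family are independent.\<close>

lemma indep_vars_permuted:
  assumes \<sigma>: "bij_betw \<sigma> {0..n} {0..n}"
  shows "indep_vars (\<lambda>_. borel) (\<lambda>k. X (\<sigma> k)) {0..n}"
proof -
  have "indep_vars (\<lambda>j. PiM {\<sigma> j} (\<lambda>_. borel)) (\<lambda>j \<omega>. restrict (\<lambda>i. X i \<omega>) {\<sigma> j}) {0..n}"
    using \<sigma> by (intro indep_vars_restrict[OF indep])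
      (auto simp: disjoint_family_on_def bij_betw_def inj_on_def)
  from indep_vars_compose2[OF this, of "\<lambda>j f. f (\<sigma> j)" "\<lambda>_. borel"]
  show ?thesis by simp
qed

text \<open>Exchangeability: the original and the permuted family both induce the product of
  standard normal laws. Points of that product space are functions restricted to {0..n}, so
  \<open>P\<close> must depend only on those arguments.\<close>

lemma prob_permuted:
  assumes \<sigma>: "bij_betw \<sigma> {0..n} {0..n}"
    and P: "Measurable.pred (PiM {0..n} (\<lambda>_. borel)) P"
    and restr: "\<And>a. P (restrict a {0..n}) \<longleftrightarrow> P a"
  shows "prob {\<omega> \<in> space M. P (\<lambda>k. X (\<sigma> k) \<omega>)} = prob {\<omega> \<in> space M. P (\<lambda>k. X k \<omega>)}"
proof -
  let ?N = "PiM {0..n} (\<lambda>_. density lborel (normal_density 0 1))"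
  let ?B = "PiM {0..n} (\<lambda>_. borel :: real measure)"
  define E where "E = {a \<in> space ?B. P a}"
  have E: "E \<in> sets ?B" using P by (simp add: E_def)
  have law: "prob {\<omega> \<in> space M. P (\<lambda>k. Y k \<omega>)} = measure ?N E"
    if Y: "indep_vars (\<lambda>_. borel) Y {0..n}"
      and d: "\<And>k. k \<le> n \<Longrightarrow> distr M borel (Y k) = density lborel (normal_density 0 1)" for Y
  proof -
    have rv: "Y k \<in> borel_measurable M" if "k \<in> {0..n}" for k using Y that by (auto simp: indep_vars_def)
    have "distr M ?B (\<lambda>\<omega>. \<lambda>k\<in>{0..n}. Y k \<omega>) = PiM {0..n} (\<lambda>k. distr M borel (Y k))"
      using Y by (subst (asm) indep_vars_iff_distr_eq_PiM') (use rv in auto)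
    also have "\<dots> = ?N" using d by (intro PiM_cong) auto
    finally have "measure ?N E = measure (distr M ?B (\<lambda>\<omega>. \<lambda>k\<in>{0..n}. Y k \<omega>)) E" by simp
    also have "\<dots> = prob ((\<lambda>\<omega>. \<lambda>k\<in>{0..n}. Y k \<omega>) -` E \<inter> space M)"
      using E rv by (intro measure_distr measurable_restrict) auto
    also have "(\<lambda>\<omega>. \<lambda>k\<in>{0..n}. Y k \<omega>) -` E \<inter> space M = {\<omega> \<in> space M. P (\<lambda>k. Y k \<omega>)}"
      using restr by (auto simp: E_def space_PiM)
    finally show ?thesis by simp
  qed
  have "\<sigma> k \<le> n" if "k \<le> n" for k using \<sigma> that by (auto simp: bij_betw_def)
  thus ?thesis
    using law[OF indep distr_coeff] law[OF indep_vars_permuted[OF \<sigma>] distr_coeff] by simp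
qed

text \<open>Dividing by \<open>X 3\<close> isolates \<open>X 0\<close>, which has no atoms and is
  independent of the quotient. The value 0 that division takes where \<open>X 3\<close> vanishes is
  harmless, since this happens with probability 0.\<close>

lemma AE_coeff_products_neq:
  assumes n: "3 \<le> n"
  shows "AE \<omega> in M. X 0 \<omega> * X 3 \<omega> \<noteq> X 1 \<omega> * X 2 \<omega>"
proof -
  let ?Y = "\<lambda>\<omega>. X 1 \<omega> * X 2 \<omega> / X 3 \<omega>"
  have "indep_var (PiM {0} (\<lambda>_. borel)) (\<lambda>\<omega>. restrict (\<lambda>i. X i \<omega>) {0})
      (PiM {1, 2, 3} (\<lambda>_. borel)) (\<lambda>\<omega>. restrict (\<lambda>i. X i \<omega>) {1, 2, 3})"
    using n by (intro indep_var_restrict[OF indep]) auto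
  from indep_var_compose[OF this, of "\<lambda>f. f 0" borel "\<lambda>f. f 1 * f 2 / f 3" borel]
  have "indep_var borel (X 0) borel ?Y" by (simp add: comp_def)
  hence "AE \<omega> in M. X 0 \<omega> \<noteq> ?Y \<omega>"
    by (rule indep_var_AE_neq) (simp add: prob_coeff_eq)
  moreover have "AE \<omega> in M. X 3 \<omega> \<noteq> 0" using n by (rule AE_coeff_neq)
  ultimately show ?thesis by eventually_elim (auto simp: field_simps)
qed

text \<open>Swapping \<open>X 0\<close> with \<open>X 1\<close> and \<open>X 2\<close> with \<open>X 3\<close> preserves the joint law and the common sign,
  and reverses the inequality.\<close>

lemma prob_same_sign_products_less:
  assumes n: "3 \<le> n"
  shows "prob {\<omega> \<in> space M. same_sign n (\<lambda>k. X k \<omega>) \<and> X 0 \<omega> * X 3 \<omega> < X 1 \<omega> * X 2 \<omega>} = 1 / 2 ^ Suc n"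
proof -
  \<comment> \<open>Indices above 3 stay fixed, so the same involution serves degree three and
    degree four.\<close>
  define \<sigma> :: "nat \<Rightarrow> nat" where
    "\<sigma> k = (if k = 0 then 1 else if k = 1 then 0 else if k = 2 then 3 else if k = 3 then 2 else k)" for k
  define P where "P a \<longleftrightarrow> same_sign n a \<and> a 0 * a 3 < a 1 * a 2" for a :: "nat \<Rightarrow> real"
  have \<sigma>\<sigma>: "\<sigma> (\<sigma> k) = k" for k by (auto simp: \<sigma>_def)
  have \<sigma>n: "\<sigma> k \<le> n \<longleftrightarrow> k \<le> n" for k using n by (auto simp: \<sigma>_def)
  have bij: "bij_betw \<sigma> {0..n} {0..n}"
    by (rule bij_betw_byWitness[where f' = \<sigma>]) (auto simp: \<sigma>\<sigma> \<sigma>n)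
  have sign: "same_sign n (\<lambda>k. a (\<sigma> k)) \<longleftrightarrow> same_sign n a" for a
  proof -
    have "(\<forall>k\<le>n. Q (a (\<sigma> k))) \<longleftrightarrow> (\<forall>k\<le>n. Q (a k))" for Q
      using \<sigma>n by (auto dest: spec[of _ "\<sigma> _"] simp: \<sigma>\<sigma>)
    from this[of "\<lambda>x. x > 0"] this[of "\<lambda>x. x < 0"] show ?thesis unfolding same_sign_def by simp
  qed
  have "Measurable.pred (PiM {0..n} (\<lambda>_. borel))
      (\<lambda>a. ((\<forall>k\<in>{0..n}. a k > 0) \<or> (\<forall>k\<in>{0..n}. a k < 0)) \<and> a 0 * a 3 < a 1 * (a 2 :: real))"
  proof -
    have c: "(\<lambda>a. a k) \<in> borel_measurable (PiM {0..n} (\<lambda>_. borel :: real measure))" if "k \<in> {0..n}" for k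
      using that by (rule measurable_component_singleton)
    show ?thesis
      using n by (intro pred_intros_logic pred_intros_finite borel_measurable_pred_less borel_measurable_times
          borel_measurable_const c) auto
  qed
  also have "(\<lambda>a. ((\<forall>k\<in>{0..n}. a k > 0) \<or> (\<forall>k\<in>{0..n}. a k < 0)) \<and> a 0 * a 3 < a 1 * (a 2 :: real)) = P"
    by (rule ext) (auto simp: P_def same_sign_def)
  finally have P: "Measurable.pred (PiM {0..n} (\<lambda>_. borel)) P" .
  have "P (restrict a {0..n}) \<longleftrightarrow> P a" for a using n by (simp add: P_def same_sign_def)
  from prob_permuted[OF bij P this]
  have "prob {\<omega> \<in> space M. P (\<lambda>k. X (\<sigma> k) \<omega>)} = prob {\<omega> \<in> space M. P (\<lambda>k. X k \<omega>)}" .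
  hence eq: "prob {\<omega> \<in> space M. same_sign n (\<lambda>k. X k \<omega>) \<and> X 1 \<omega> * X 2 \<omega> < X 0 \<omega> * X 3 \<omega>}
      = prob {\<omega> \<in> space M. same_sign n (\<lambda>k. X k \<omega>) \<and> X 0 \<omega> * X 3 \<omega> < X 1 \<omega> * X 2 \<omega>}" (is "prob ?G = prob ?L")
    unfolding P_def sign[of "\<lambda>k. X k _"] by (simp add: \<sigma>_def)
  note [measurable] = pred_same_sign[OF order_refl]
  have [measurable]: "X 0 \<in> borel_measurable M" "X 1 \<in> borel_measurable M"
    "X 2 \<in> borel_measurable M" "X 3 \<in> borel_measurable M" using n by auto
  have sets: "?G \<in> events" "?L \<in> events" by measurable
  have "1 / 2 ^ n = prob {\<omega> \<in> space M. same_sign n (\<lambda>k. X k \<omega>)}" by (simp add: prob_same_sign)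
  \<comment> \<open>Ties are null, so the two strict inequalities split the common-sign event into
    two parts of equal probability.\<close>
  also have "\<dots> = prob (?G \<union> ?L)"
    using AE_coeff_products_neq[OF n] sets by (intro measure_eq_AE) (auto simp: neq_iff)
  also have "\<dots> = prob ?G + prob ?L" using sets by (intro finite_measure_Union) auto
  finally show ?thesis using eq by simp
qed

text \<open>The two events differ by the measurable null set on which all coefficients vanish, so either both
  are measurable or both have measure 0 by convention.\<close>

lemma prob_stable_eq_prob_roots:
  "prob {\<omega> \<in> space M. zero_globally_asymptotically_stable (poly_of_coeffs n (\<lambda>k. X k \<omega>))}
    = prob {\<omega> \<in> space M. all_roots_neg_Re (poly_of_coeffs n (\<lambda>k. X k \<omega>))}" (is "prob ?S = prob ?R")
proof -
  define Z where "Z = {\<omega> \<in> space M. \<forall>k\<le>n. X k \<omega> \<in> {0}}"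
  have Z: "Z \<in> events" unfolding Z_def using pred_all_coeffs[of "\<lambda>_. {0}"] by simp
  have "prob Z \<le> prob {\<omega> \<in> space M. X 0 \<omega> = 0}"
  proof (rule finite_measure_mono)
    show "Z \<subseteq> {\<omega> \<in> space M. X 0 \<omega> = 0}" by (auto simp: Z_def)
  qed measurable
  hence "prob Z = 0" using prob_coeff_eq[of 0 0] measure_nonneg[of M Z] by simp
  hence null: "Z \<in> null_sets M" using Z by (simp add: null_sets_def emeasure_eq_measure)
  have zero: "poly_of_coeffs n a = 0 \<longleftrightarrow> (\<forall>k\<le>n. a k = 0)" for a
    by (auto simp: poly_eq_iff coeff_poly_of_coeffs)
  have "\<not> all_roots_neg_Re 0" by (auto simp: all_roots_neg_Re_def intro!: exI[of _ 0])
  hence nz: "\<not> all_roots_neg_Re (poly_of_coeffs n a)" if "poly_of_coeffs n a = 0" for a using that by simp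
  have "Z = {\<omega> \<in> space M. poly_of_coeffs n (\<lambda>k. X k \<omega>) = 0}" by (auto simp: Z_def zero)
  hence RZ: "?S = ?R \<union> Z" "?R = ?S - Z"
    using nz by (auto simp: zero_globally_asymptotically_stable_iff)
  show ?thesis
  proof (cases "?R \<in> events")
    case True
    thus ?thesis using null unfolding RZ(1) by (rule measure_Un_null_set)
  next
    case False
    have "?S \<notin> events"
    proof
      assume "?S \<in> events"
      from sets.Diff[OF this Z] show False using False by (simp only: RZ(2)[symmetric])
    qed
    thus ?thesis using False by (simp add: measure_notin_sets)
  qed
qed

text \<open>The root event lies in the union of the event \<open>P\<close> and the null event that
  \<open>X n\<close> vanishes. Monotonicity of \<open>measure\<close> only asks for measurability of
  this larger set, a non-measurable set having measure 0 by convention.\<close>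

lemma prob_roots_le:
  assumes P: "Measurable.pred M P"
    and imp: "\<And>\<omega>. all_roots_neg_Re (poly_of_coeffs n (\<lambda>k. X k \<omega>)) \<Longrightarrow> X n \<omega> \<noteq> 0 \<Longrightarrow> P \<omega>"
  shows "prob {\<omega> \<in> space M. all_roots_neg_Re (poly_of_coeffs n (\<lambda>k. X k \<omega>))} \<le> prob {\<omega> \<in> space M. P \<omega>}"
proof -
  have ev: "{\<omega> \<in> space M. X n \<omega> = 0} \<in> events" "{\<omega> \<in> space M. P \<omega>} \<in> events" using P by auto
  have "prob {\<omega> \<in> space M. all_roots_neg_Re (poly_of_coeffs n (\<lambda>k. X k \<omega>))}
      \<le> prob ({\<omega> \<in> space M. P \<omega>} \<union> {\<omega> \<in> space M. X n \<omega> = 0})"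
    using ev imp by (intro finite_measure_mono) auto
  also have "\<dots> = prob {\<omega> \<in> space M. P \<omega>}"
    using ev prob_coeff_eq[of n 0] by (intro measure_Un_null_set) (auto simp: null_sets_def emeasure_eq_measure)
  finally show ?thesis .
qed

text \<open>Equality requires the root event itself to be measurable: altering \<open>P\<close> on a
  null set could destroy measurability in an incomplete space, and \<open>measure\<close> would then
  return 0.\<close>

lemma prob_roots_eq:
  assumes "Measurable.pred M P"
    and R: "Measurable.pred M (\<lambda>\<omega>. all_roots_neg_Re (poly_of_coeffs n (\<lambda>k. X k \<omega>)))"
    and iff: "\<And>\<omega>. X n \<omega> \<noteq> 0 \<Longrightarrow> all_roots_neg_Re (poly_of_coeffs n (\<lambda>k. X k \<omega>)) \<longleftrightarrow> P \<omega>"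
  shows "prob {\<omega> \<in> space M. all_roots_neg_Re (poly_of_coeffs n (\<lambda>k. X k \<omega>))} = prob {\<omega> \<in> space M. P \<omega>}"
proof (rule measure_eq_AE)
  show "AE \<omega> in M. \<omega> \<in> {\<omega> \<in> space M. all_roots_neg_Re (poly_of_coeffs n (\<lambda>k. X k \<omega>))} \<longleftrightarrow>
      \<omega> \<in> {\<omega> \<in> space M. P \<omega>}"
    using AE_coeff_neq[OF order_refl, of 0] by eventually_elim (auto simp: iff)
qed (use assms in \<open>auto simp: pred_def\<close>)

section \<open>Measurability of the root event up to degree three\<close>

lemma pred_roots_0: "Measurable.pred M (\<lambda>\<omega>. all_roots_neg_Re (poly_of_coeffs 0 (\<lambda>k. X k \<omega>)))"
  unfolding all_roots_neg_Re_0 by measurable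

text \<open>Where the leading coefficient vanishes the polynomial is the one of the previous degree;
  elsewhere the explicit criterion decides. This describes the event exactly and not merely up to a
  null set.\<close>

lemma pred_roots_Suc:
  assumes m: "Suc m \<le> n"
    and prev: "Measurable.pred M (\<lambda>\<omega>. all_roots_neg_Re (poly_of_coeffs m (\<lambda>k. X k \<omega>)))"
    and P: "Measurable.pred M P"
    and iff: "\<And>\<omega>. X (Suc m) \<omega> \<noteq> 0 \<Longrightarrow> all_roots_neg_Re (poly_of_coeffs (Suc m) (\<lambda>k. X k \<omega>)) \<longleftrightarrow> P \<omega>"
  shows "Measurable.pred M (\<lambda>\<omega>. all_roots_neg_Re (poly_of_coeffs (Suc m) (\<lambda>k. X k \<omega>)))"
proof -
  have "(\<lambda>\<omega>. all_roots_neg_Re (poly_of_coeffs (Suc m) (\<lambda>k. X k \<omega>)))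
      = (\<lambda>\<omega>. if X (Suc m) \<omega> = 0 then all_roots_neg_Re (poly_of_coeffs m (\<lambda>k. X k \<omega>)) else P \<omega>)"
    by (rule ext) (simp add: poly_of_coeffs_Suc_eq iff)
  moreover note [measurable] = prev P random_variable_coeff[OF m]
  have "Measurable.pred M (\<lambda>\<omega>. if X (Suc m) \<omega> = 0 then all_roots_neg_Re (poly_of_coeffs m (\<lambda>k. X k \<omega>)) else P \<omega>)"
    by measurable
  ultimately show ?thesis by simp
qed

lemma pred_products_less:
  assumes "i \<le> n" "j \<le> n" "k \<le> n" "l \<le> n"
  shows "Measurable.pred M (\<lambda>\<omega>. X i \<omega> * X j \<omega> < X k \<omega> * X l \<omega>)"
  using assms by (intro borel_measurable_pred_less borel_measurable_times random_variable_coeff)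

lemma pred_roots_1:
  assumes "1 \<le> n"
  shows "Measurable.pred M (\<lambda>\<omega>. all_roots_neg_Re (poly_of_coeffs 1 (\<lambda>k. X k \<omega>)))"
  unfolding One_nat_def
proof (rule pred_roots_Suc[OF _ pred_roots_0])
  show "Measurable.pred M (\<lambda>\<omega>. same_sign 1 (\<lambda>k. X k \<omega>))" using assms by (rule pred_same_sign)
  show "all_roots_neg_Re (poly_of_coeffs (Suc 0) (\<lambda>k. X k \<omega>)) \<longleftrightarrow> same_sign 1 (\<lambda>k. X k \<omega>)"
    if "X (Suc 0) \<omega> \<noteq> 0" for \<omega>
    using all_roots_neg_Re_1[of "\<lambda>k. X k \<omega>"] that by simp
qed (use assms in simp)

lemma pred_roots_2:
  assumes "2 \<le> n"
  shows "Measurable.pred M (\<lambda>\<omega>. all_roots_neg_Re (poly_of_coeffs 2 (\<lambda>k. X k \<omega>)))"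
proof -
  have "Measurable.pred M (\<lambda>\<omega>. all_roots_neg_Re (poly_of_coeffs (Suc 1) (\<lambda>k. X k \<omega>)))"
  proof (rule pred_roots_Suc)
    show "Measurable.pred M (\<lambda>\<omega>. same_sign 2 (\<lambda>k. X k \<omega>))" using assms by (rule pred_same_sign)
    show "all_roots_neg_Re (poly_of_coeffs (Suc 1) (\<lambda>k. X k \<omega>)) \<longleftrightarrow> same_sign 2 (\<lambda>k. X k \<omega>)"
      if "X (Suc 1) \<omega> \<noteq> 0" for \<omega>
      using all_roots_neg_Re_2[of "\<lambda>k. X k \<omega>"] that by (simp add: numeral_2_eq_2)
  qed (use assms pred_roots_1 in auto)
  thus ?thesis by (simp add: numeral_2_eq_2)
qed

lemma pred_roots_3:
  assumes "3 \<le> n"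
  shows "Measurable.pred M (\<lambda>\<omega>. all_roots_neg_Re (poly_of_coeffs 3 (\<lambda>k. X k \<omega>)))"
proof -
  have "Measurable.pred M (\<lambda>\<omega>. all_roots_neg_Re (poly_of_coeffs (Suc 2) (\<lambda>k. X k \<omega>)))"
  proof (rule pred_roots_Suc)
    show "Measurable.pred M (\<lambda>\<omega>. same_sign 3 (\<lambda>k. X k \<omega>) \<and> X 0 \<omega> * X 3 \<omega> < X 1 \<omega> * X 2 \<omega>)"
      using assms by (intro pred_intros_logic pred_same_sign pred_products_less) auto
    show "all_roots_neg_Re (poly_of_coeffs (Suc 2) (\<lambda>k. X k \<omega>))
        \<longleftrightarrow> same_sign 3 (\<lambda>k. X k \<omega>) \<and> X 0 \<omega> * X 3 \<omega> < X 1 \<omega> * X 2 \<omega>" if "X (Suc 2) \<omega> \<noteq> 0" for \<omega>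
      using all_roots_neg_Re_3[of "\<lambda>k. X k \<omega>"] that by simp
  qed (use assms pred_roots_2 in auto)
  thus ?thesis by simp
qed

text \<open>The open box below consists of coefficient vectors with \<open>X 0 * X 3 < X 1 * X 2\<close> that violate the
  further Hurwitz inequality \<open>X 1 * X 4 < X 2 * X 3\<close>; it makes the bound strict.\<close>

lemma prob_roots_4_less:
  assumes n: "n = 4"
  shows "prob {\<omega> \<in> space M. all_roots_neg_Re (poly_of_coeffs 4 (\<lambda>k. X k \<omega>))} < 1 / 32"
proof -
  \<comment> \<open>Left endpoints of unit intervals: \<open>X 0\<close> and \<open>X 3\<close> lie
    in (0,1), \<open>X 2\<close> and \<open>X 4\<close> in (1,2), \<open>X 1\<close> in (2,3). Hence
    X 0 * X 3 < 1 < X 1 * X 2, but X 2 * X 3 < 2 < X 1 * X 4.\<close>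
  define l :: "nat \<Rightarrow> real" where "l k = (if k = 1 then 2 else if k = 2 \<or> k = 4 then 1 else 0)" for k
  define B where "B k = {l k<..<l k + 1}" for k
  define G where "G \<omega> \<longleftrightarrow> same_sign n (\<lambda>k. X k \<omega>) \<and> X 0 \<omega> * X 3 \<omega> < X 1 \<omega> * X 2 \<omega>" for \<omega>
  define E where "E \<omega> \<longleftrightarrow> (\<forall>k\<le>n. X k \<omega> \<in> B k)" for \<omega>
  have pG: "Measurable.pred M G"
    unfolding G_def[abs_def] using n by (intro pred_intros_logic pred_same_sign pred_products_less) auto
  have pE: "Measurable.pred M E"
    unfolding E_def[abs_def] by (intro pred_all_coeffs) (simp add: B_def)
  have E: "G \<omega> \<and> X 2 \<omega> * X 3 \<omega> < X 1 \<omega> * X 4 \<omega>" if "E \<omega>" for \<omega>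
  proof -
    have all: "X k \<omega> \<in> B k" if "k \<le> 4" for k using \<open>E \<omega>\<close> n that by (simp add: E_def)
    have b: "0 < X 0 \<omega>" "X 0 \<omega> < 1" "2 < X 1 \<omega>" "1 < X 2 \<omega>" "X 2 \<omega> < 2" "0 < X 3 \<omega>" "X 3 \<omega> < 1" "1 < X 4 \<omega>"
      using all[of 0] all[of 1] all[of 2] all[of 3] all[of 4] by (auto simp: B_def l_def)
    have "0 < X k \<omega>" if "k \<le> n" for k
      using all[of k] that n by (auto simp: B_def l_def split: if_splits)
    moreover have "X 0 \<omega> * X 3 \<omega> < 1 * 1" using b by (intro mult_strict_mono) auto
    moreover have "1 * 1 < X 1 \<omega> * X 2 \<omega>" using b by (intro mult_strict_mono) auto
    moreover have "X 2 \<omega> * X 3 \<omega> < 2 * 1" "2 * 1 < X 1 \<omega> * X 4 \<omega>"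
      using b by (intro mult_strict_mono; simp)+
    ultimately show ?thesis by (auto simp: G_def same_sign_def)
  qed
  \<comment> \<open>The root event is contained in \<open>G\<close> up to a null set and avoids the
    box \<open>E\<close>. As \<open>E\<close> implies \<open>G\<close>, removing the box lowers the
    bound by exactly its probability.\<close>
  have "prob {\<omega> \<in> space M. all_roots_neg_Re (poly_of_coeffs n (\<lambda>k. X k \<omega>))} \<le> prob {\<omega> \<in> space M. G \<omega> \<and> \<not> E \<omega>}"
  proof (rule prob_roots_le)
    fix \<omega> assume "all_roots_neg_Re (poly_of_coeffs n (\<lambda>k. X k \<omega>))" "X n \<omega> \<noteq> 0"
    hence "G \<omega>" "X 1 \<omega> * X 4 \<omega> < X 2 \<omega> * X 3 \<omega>"
      using all_roots_neg_Re_4[of "\<lambda>k. X k \<omega>"] n by (simp_all add: G_def)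
    thus "G \<omega> \<and> \<not> E \<omega>" using E[of \<omega>] by auto
  qed (use pG pE in simp)
  also have "{\<omega> \<in> space M. G \<omega> \<and> \<not> E \<omega>} = {\<omega> \<in> space M. G \<omega>} - {\<omega> \<in> space M. E \<omega>}" by auto
  also have "prob \<dots> = prob {\<omega> \<in> space M. G \<omega>} - prob {\<omega> \<in> space M. E \<omega>}"
    using pG pE E by (intro finite_measure_Diff) auto
  also have "prob {\<omega> \<in> space M. G \<omega>} = 1 / 32"
    using prob_same_sign_products_less n by (simp add: G_def)
  finally have "prob {\<omega> \<in> space M. all_roots_neg_Re (poly_of_coeffs 4 (\<lambda>k. X k \<omega>))} \<le> 1 / 32 - prob {\<omega> \<in> space M. E \<omega>}"
    by (simp add: n)
  \<comment> \<open>By independence the box has the product of five interval probabilities, each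
    positive.\<close>
  moreover have "prob {\<omega> \<in> space M. E \<omega>} > 0"
    unfolding E_def B_def
    by (subst prob_all_coeffs) (simp, intro prod_pos ballI prob_coeff_open_interval_pos, auto)
  ultimately show ?thesis by simp
qed

end

theorem proposition8:
  fixes M :: "nat \<Rightarrow> 'a measure"
    and A :: "nat \<Rightarrow> nat \<Rightarrow> 'a \<Rightarrow> real"
    and r :: "nat \<Rightarrow> real"
  assumes prob: "\<And>n. n \<ge> 1 \<Longrightarrow> prob_space (M n)"
    and indep: "\<And>n. n \<ge> 1 \<Longrightarrow> prob_space.indep_vars (M n) (\<lambda>_. borel) (A n) {0..n}"
    and normal: "\<And>n k. n \<ge> 1 \<Longrightarrow> k \<le> n \<Longrightarrow>
      distributed (M n) lborel (A n k) (normal_density 0 1)"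
    and r: "\<And>n. n \<ge> 1 \<Longrightarrow> r n = measure (M n)
      {\<omega> \<in> space (M n). all_roots_neg_Re (poly_of_coeffs n (\<lambda>k. A n k \<omega>))}"
  shows "(\<forall>n\<ge>1. r n = measure (M n)
            {\<omega> \<in> space (M n).
               zero_globally_asymptotically_stable (poly_of_coeffs n (\<lambda>k. A n k \<omega>))}) \<and>
         (\<forall>n\<ge>1. r n \<le> 1 / 2 ^ n) \<and>
         r 1 = 1 / 2 \<and> r 2 = 1 / 4 \<and> r 3 = 1 / 16 \<and>
         r 4 < r 3 / 2 \<and> r 3 / 2 = 1 / 32"
proof -
  have g: "gaussian_coeffs (M n) n (A n)" if "n \<ge> 1" for n
    using prob indep normal that by (simp add: gaussian_coeffs_def gaussian_coeffs_axioms_def)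
  interpret g1: gaussian_coeffs "M 1" 1 "A 1" by (rule g) simp
  interpret g2: gaussian_coeffs "M 2" 2 "A 2" by (rule g) simp
  interpret g3: gaussian_coeffs "M 3" 3 "A 3" by (rule g) simp
  interpret g4: gaussian_coeffs "M 4" 4 "A 4" by (rule g) simp
  have "r n = measure (M n) {\<omega> \<in> space (M n).
      zero_globally_asymptotically_stable (poly_of_coeffs n (\<lambda>k. A n k \<omega>))}" if "n \<ge> 1" for n
    using gaussian_coeffs.prob_stable_eq_prob_roots[OF g[OF that]] r[OF that] by simp
  moreover have "r n \<le> 1 / 2 ^ n" if "n \<ge> 1" for n
  proof -
    interpret gaussian_coeffs "M n" n "A n" by (rule g[OF that])
    show ?thesis
      using prob_roots_le[OF pred_same_sign[OF order_refl] same_sign_if_all_roots_neg_Re]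
      by (simp add: r[OF that] prob_same_sign)
  qed
  moreover have "r 1 = 1 / 2"
    using g1.prob_roots_eq[OF g1.pred_same_sign[OF order_refl] g1.pred_roots_1[OF order_refl] all_roots_neg_Re_1]
      g1.prob_same_sign r[of 1] by simp
  moreover have "r 2 = 1 / 4"
    using g2.prob_roots_eq[OF g2.pred_same_sign[OF order_refl] g2.pred_roots_2[OF order_refl] all_roots_neg_Re_2]
      g2.prob_same_sign r[of 2] by simp
  moreover have r3: "r 3 = 1 / 16"
  proof -
    have "Measurable.pred (M 3) (\<lambda>\<omega>. same_sign 3 (\<lambda>k. A 3 k \<omega>) \<and> A 3 0 \<omega> * A 3 3 \<omega> < A 3 1 \<omega> * A 3 2 \<omega>)"
      by (intro pred_intros_logic g3.pred_same_sign g3.pred_products_less) auto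
    from g3.prob_roots_eq[OF this g3.pred_roots_3[OF order_refl] all_roots_neg_Re_3]
    show ?thesis using g3.prob_same_sign_products_less r[of 3] by simp
  qed
  moreover have "r 4 < r 3 / 2" using g4.prob_roots_4_less r[of 4] r3 by simp
  ultimately show ?thesis by simp
qed

end
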